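(* For every point $P$ in the interior of the unit square $[0,1]\times[0,1]$, there exist slopes such that a particle (with the single-wall bomb) starting at $P$ with the given slope tunnels periodically with arbitrarily large period; i.e. for every $N$ there is a slope $s$ such that the particle starting at $P$ with slope $s$ digs a periodic tunnel of period greater than $N$.
   Context: Dynamics (single-wall bomb). The plane is covered by the unit square grid. The walls are the unit-length edges joining adjacent points of $\mathbb{Z}^2$ (each horizontal or vertical); the corners are the points of $\mathbb{Z}^2$. Initially every wall is solid. A particle starts at a given point; "slope $s$" means its initial direction is $(1,s)/\sqrt{1+s^2}$ (so up and to the right for $s>0$). It moves in a straight line until it collides with a solid wall; it then reflects off, preserving the angle of incidence, and the wall hit is permanently erased. It passes freely through erased walls. If it reaches a corner it stops (whether or not the adjacent walls have been erased). Tunnels. A band is the set of points of the plane within a given finite distance of some ray $\ell$. A particle tunnels if it runs infinitely (without hitting a corner) and, for some $r$, every wall it collides with outside a disc of radius $r$ is contained in a finite union of bands. The tunnel is periodic if, for sufficiently large $r$, there is a positive integer $k$ such that (for collisions outside the disc) the wall hit in collision $n+k$ is always of the same type (horizontal/vertical) as the wall hit in collision $n$, and the displacement from the wall hit in collision $n$ to that hit in collision $n+k$ depends only on which band contains the wall hit in collision $n$; the least such $k$ is the period. *)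

theory Defs
  imports "HOL-Analysis.Analysis"
begin

section \<open>The grid\<close>

type_synonym point = "real \<times> real"

definition corners :: "point set" where
  "corners = \<int> \<times> \<int>"

text \<open>A wall is named by its direction and its left (respectively lower) end point.\<close>

datatype wall = Horizontal int int | Vertical int int

fun end_point :: "wall \<Rightarrow> point" where
  "end_point (Horizontal i j) = (of_int i, of_int j)"
| "end_point (Vertical i j) = (of_int i, of_int j)"

fun wall_points :: "wall \<Rightarrow> point set" where
  "wall_points (Horizontal i j) =
     closed_segment (of_int i, of_int j) (of_int i + 1, of_int j)"
| "wall_points (Vertical i j) =
     closed_segment (of_int i, of_int j) (of_int i, of_int j + 1)"

fun same_type :: "wall \<Rightarrow> wall \<Rightarrow> bool" where
  "same_type (Horizontal _ _) (Horizontal _ _) = True"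
| "same_type (Vertical _ _) (Vertical _ _) = True"
| "same_type _ _ = False"

text \<open>For walls of the same type this is the translation taking the first to the second.\<close>

definition displacement :: "wall \<Rightarrow> wall \<Rightarrow> point" where
  "displacement w w' = end_point w' - end_point w"

section \<open>The particle with the single-wall bomb\<close>

fun reflect :: "wall \<Rightarrow> point \<Rightarrow> point" where
  "reflect (Horizontal _ _) (a, b) = (a, - b)"
| "reflect (Vertical _ _) (a, b) = (- a, b)"

text \<open>
  A particle leaving \<open>p\<close> in direction \<open>v\<close>, when \<open>S\<close> is the set of solid walls, next collides
  at the point \<open>p'\<close> with the wall \<open>w\<close>: until then it meets no other solid wall, and it meets
  no corner (even one all of whose walls are erased), at \<open>p'\<close> included.
\<close>

definition collides :: "wall set \<Rightarrow> point \<Rightarrow> point \<Rightarrow> wall \<Rightarrow> point \<Rightarrow> bool" where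
  "collides S p v w p' \<longleftrightarrow>
     w \<in> S \<and>
     (\<exists>t>0. p' = p + t *\<^sub>R v \<and> p' \<in> wall_points w \<and>
            (\<forall>t'\<in>{0<..t}. p + t' *\<^sub>R v \<notin> corners) \<and>
            (\<forall>t'\<in>{0<..<t}. \<forall>w'\<in>S. p + t' *\<^sub>R v \<notin> wall_points w'))"

definition initial_direction :: "real \<Rightarrow> point" where
  "initial_direction s = (1 / sqrt (1 + s\<^sup>2)) *\<^sub>R (1, s)"

text \<open>
  \<open>runs_forever P s q w\<close>: the particle starting at \<open>P\<close> with slope \<open>s\<close> runs infinitely;
  \<open>q 0 = P\<close>, and collision number \<open>n = 0, 1, \<dots>\<close> takes place at the point \<open>q (Suc n)\<close>
  with the wall \<open>w n\<close>.  Running forever is the same as having an infinite sequence of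
  collisions: a ray that misses all corners crosses infinitely many walls, of which only
  finitely many have been erased, so there always is a next collision; and since no wall is
  hit twice, only finitely many collisions take place in any bounded region, so the collision
  times (the speed is 1) do not accumulate.
\<close>

definition runs_forever :: "point \<Rightarrow> real \<Rightarrow> (nat \<Rightarrow> point) \<Rightarrow> (nat \<Rightarrow> wall) \<Rightarrow> bool" where
  "runs_forever P s q w \<longleftrightarrow>
     q 0 = P \<and>
     (\<exists>v. v 0 = initial_direction s \<and>
          (\<forall>n. collides (UNIV - w ` {..<n}) (q n) (v n) (w n) (q (Suc n)) \<and>
               v (Suc n) = reflect (w n) (v n)))"

section \<open>Tunnels\<close>

text \<open>A band is given by the origin \<open>a\<close> and unit direction \<open>u\<close> of a ray, and a distance \<open>d\<close>.\<close>

type_synonym band_data = "point \<times> point \<times> real"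

fun band_points :: "band_data \<Rightarrow> point set" where
  "band_points (a, u, d) = {x. \<exists>t\<ge>0. dist x (a + t *\<^sub>R u) \<le> d}"

fun direction :: "band_data \<Rightarrow> point" where
  "direction (a, u, d) = u"

definition finite_bands :: "band_data set \<Rightarrow> bool" where
  "finite_bands B \<longleftrightarrow> finite B \<and> (\<forall>(a, u, d)\<in>B. norm u = 1 \<and> d \<ge> 0)"

text \<open>
  Discs are centred at the origin.  As only the behaviour for large radii matters, any other
  fixed centre would give the same notions.
\<close>

definition outside_disc :: "real \<Rightarrow> (nat \<Rightarrow> point) \<Rightarrow> nat set" where
  "outside_disc r q = {n. q (Suc n) \<notin> cball 0 r}"

definition tunnels :: "point \<Rightarrow> real \<Rightarrow> (nat \<Rightarrow> point) \<Rightarrow> (nat \<Rightarrow> wall) \<Rightarrow> bool" where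
  "tunnels P s q w \<longleftrightarrow>
     runs_forever P s q w \<and>
     (\<exists>r B. finite_bands B \<and>
            (\<forall>n\<in>outside_disc r q. wall_points (w n) \<subseteq> (\<Union>b\<in>B. band_points b)))"

text \<open>
  For a periodic tunnel one speaks of the band that contains a wall.  To make sense of this,
  the bands are taken to have pairwise different directions (bands in the same direction
  merge into one wider band), so that they are pairwise disjoint outside a large disc, and
  each far wall is required to lie in a single one of them.  Any two such families put the
  same walls together, up to finitely many walls, so the period below does not depend on the
  family.  With bands in the same direction allowed it would: cutting one band lengthwise
  into narrow parallel ones can lower the period.
\<close>

definition tunnel_bands :: "(nat \<Rightarrow> point) \<Rightarrow> (nat \<Rightarrow> wall) \<Rightarrow> band_data set \<Rightarrow> bool" where
  "tunnel_bands q w B \<longleftrightarrow>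
     finite_bands B \<and> inj_on direction B \<and>
     (\<forall>\<^sub>F r in at_top. \<forall>n\<in>outside_disc r q. \<exists>b\<in>B. wall_points (w n) \<subseteq> band_points b)"

definition repeats ::
  "(nat \<Rightarrow> point) \<Rightarrow> (nat \<Rightarrow> wall) \<Rightarrow> band_data set \<Rightarrow> real \<Rightarrow> nat \<Rightarrow> bool" where
  "repeats q w B r k \<longleftrightarrow>
     k > 0 \<and>
     (\<forall>n\<in>outside_disc r q. same_type (w n) (w (n + k))) \<and>
     (\<exists>D. \<forall>n\<in>outside_disc r q. \<forall>b\<in>B.
            wall_points (w n) \<subseteq> band_points b \<longrightarrow> displacement (w n) (w (n + k)) = D b)"

definition tunnels_periodically ::
  "point \<Rightarrow> real \<Rightarrow> (nat \<Rightarrow> point) \<Rightarrow> (nat \<Rightarrow> wall) \<Rightarrow> bool" where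
  "tunnels_periodically P s q w \<longleftrightarrow>
     tunnels P s q w \<and>
     (\<exists>B. tunnel_bands q w B \<and> (\<forall>\<^sub>F r in at_top. \<exists>k. repeats q w B r k))"

text \<open>
  Enlarging \<open>r\<close> only weakens \<^const>\<open>repeats\<close>, so in a periodic tunnel some \<open>k\<close> works for all
  large \<open>r\<close>, and the least element below exists.
\<close>

definition period :: "(nat \<Rightarrow> point) \<Rightarrow> (nat \<Rightarrow> wall) \<Rightarrow> nat" where
  "period q w =
     (LEAST k. \<exists>B. tunnel_bands q w B \<and> (\<forall>\<^sub>F r in at_top. repeats q w B r k))"

end

theory Submission
  imports Defs
begin

text \<open>
  Take slope \<open>\<plusminus>n/(3n+1)\<close> with \<open>n = 3l + 17\<close>, and measure time so that the horizontal speed is 1.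
  The particle then meets vertical grid lines at unit intervals and horizontal ones at intervals
  \<open>T = 3 + \<epsilon>\<close>, \<open>\<epsilon> = 1/n\<close>; so everything is governed by the order of these two kinds of events.  Let
  \<open>a\<close> be the time that remains until the next vertical line when a horizontal line is reached.
  Exactly three vertical lines follow before the next horizontal one if \<open>a > \<epsilon>\<close>, and \<open>a\<close> drops by
  \<open>\<epsilon>\<close>; if \<open>a < \<epsilon>\<close> there are four.

  As long as \<open>a > 3\<epsilon>\<close>, a particle entering an untouched row through the only gap in its boundary
  hits six walls and leaves, in the same direction, through the only gap it makes in the opposite
  boundary, one column and one row further: this is the tunnel of slope 1/3.  When \<open>a < 3\<epsilon>\<close> it loses
  step, wanders back into the previous row, hits twenty walls, and enters an untouched row again
  three columns and two rows further, with \<open>a\<close> increased by \<open>1 - 14\<epsilon>\<close>.  After \<open>l + 1\<close> further rows \<open>a\<close>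
  has its old value, because \<open>n \<equiv> 2 (mod 3)\<close>, and the pattern repeats, displaced by
  \<open>(l + 4, l + 3)\<close>.  Two consecutive hits of horizontal walls occur only when the particle loses
  step, whereas the hits in the \<open>l + 1\<close> regular rows have the types V V H V H V over and over; so the period
  exceeds \<open>6l\<close>.

  From any starting point, for \<open>n\<close> large, the particle enters an untouched row in this way after
  at most eight horizontal lines.  No corner is ever met if \<open>n(1 - x) - \<beta>(3n + 1)\<close> is not an integer,
  where \<open>\<beta> = 1 - y\<close> for positive and \<open>\<beta> = y\<close> for negative slope; among both slopes and two consecutive
  values of \<open>l\<close> there is always a good choice.
\<close>

section \<open>Combinatorics of the particle\<close>

text \<open>
  A state consists of the column and the row of the current cell and of two flags: whether the
  particle moves right, and whether it moves up.  The flag of an event tells whether a vertical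
  grid line is reached.
\<close>

type_synonym state = "int \<times> int \<times> bool \<times> bool"

fun next_wall :: "state \<Rightarrow> bool \<Rightarrow> wall" where
  "next_wall (i, j, right, up) True = Vertical (if right then i + 1 else i) j"
| "next_wall (i, j, right, up) False = Horizontal i (if up then j + 1 else j)"

text \<open>The last flag says whether the wall ahead is still solid: then the particle stays in its
  cell and turns back, otherwise it enters the neighbouring cell.\<close>

fun move :: "state \<Rightarrow> bool \<Rightarrow> bool \<Rightarrow> state" where
  "move (i, j, right, up) True True = (i, j, \<not> right, up)"
| "move (i, j, right, up) True False = (if right then i + 1 else i - 1, j, right, up)"
| "move (i, j, right, up) False True = (i, j, right, \<not> up)"
| "move (i, j, right, up) False False = (i, if up then j + 1 else j - 1, right, up)"

text \<open>The list has two roles: as a set it holds the erased walls, and its order records the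
  collisions.\<close>

definition cross :: "bool \<Rightarrow> state \<times> wall list \<Rightarrow> state \<times> wall list" where
  "cross e c =
     (let x = next_wall (fst c) e in
      if x \<in> set (snd c) then (move (fst c) e False, snd c)
      else (move (fst c) e True, snd c @ [x]))"

fun walls_met :: "bool list \<Rightarrow> state \<times> wall list \<Rightarrow> wall list" where
  "walls_met [] c = []"
| "walls_met (e # es) c = next_wall (fst c) e # walls_met es (cross e c)"

section \<open>Symmetries of the grid and transfer of finite simulations\<close>

fun height :: "wall \<Rightarrow> int" where
  "height (Horizontal i j) = j"
| "height (Vertical i j) = j"

fun horizontal :: "wall \<Rightarrow> bool" where
  "horizontal (Horizontal i j) = True"
| "horizontal (Vertical i j) = False"

lemma same_type_iff: "same_type x y \<longleftrightarrow> horizontal x = horizontal y"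
  by (cases x; cases y) auto

text \<open>\<open>f\<close> acts on walls and \<open>g\<close> on states, compatibly with the
  dynamics. By the last clause a constant nonzero drift is still constant and nonzero after
  transport.\<close>

definition symmetry :: "(wall \<Rightarrow> wall) \<Rightarrow> (state \<Rightarrow> state) \<Rightarrow> bool" where
  "symmetry f g \<longleftrightarrow>
     inj f \<and>
     (\<forall>s e. next_wall (g s) e = f (next_wall s e)) \<and>
     (\<forall>s e b. move (g s) e b = g (move s e b)) \<and>
     (\<forall>x. horizontal (f x) = horizontal x) \<and>
     (\<exists>\<alpha> \<beta>. \<alpha> \<noteq> 0 \<and> \<beta> \<noteq> 0 \<and>
        (\<forall>x y. same_type x y \<longrightarrow>
           displacement (f x) (f y) =
             (\<alpha> * fst (displacement x y), \<beta> * snd (displacement x y))))"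

fun shift :: "int \<Rightarrow> int \<Rightarrow> wall \<Rightarrow> wall" where
  "shift x y (Horizontal i j) = Horizontal (x + i) (y + j)"
| "shift x y (Vertical i j) = Vertical (x + i) (y + j)"

fun shift_state :: "int \<Rightarrow> int \<Rightarrow> state \<Rightarrow> state" where
  "shift_state x y (i, j, right, up) = (x + i, y + j, right, up)"

text \<open>
  Reflections that map the cell (0, 0) to itself.
\<close>

fun flip_x :: "wall \<Rightarrow> wall" where
  "flip_x (Horizontal i j) = Horizontal (- i) j"
| "flip_x (Vertical i j) = Vertical (1 - i) j"

fun flip_x_state :: "state \<Rightarrow> state" where
  "flip_x_state (i, j, right, up) = (- i, j, \<not> right, up)"

fun flip_y :: "wall \<Rightarrow> wall" where
  "flip_y (Horizontal i j) = Horizontal i (1 - j)"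
| "flip_y (Vertical i j) = Vertical i (- j)"

fun flip_y_state :: "state \<Rightarrow> state" where
  "flip_y_state (i, j, right, up) = (i, - j, right, \<not> up)"

lemma displacement_simps:
  "displacement (Horizontal i j) (Horizontal i' j') = (of_int (i' - i), of_int (j' - j))"
  "displacement (Vertical i j) (Vertical i' j') = (of_int (i' - i), of_int (j' - j))"
  by (auto simp: displacement_def)

lemma symmetry_shift: "symmetry (shift x y) (shift_state x y)"
proof -
  have "inj (shift x y)"
  proof (rule injI)
    fix u v assume "shift x y u = shift x y v"
    then show "u = v" by (cases u; cases v) auto
  qed
  moreover have "next_wall (shift_state x y s) e = shift x y (next_wall s e)"
    "move (shift_state x y s) e b = shift_state x y (move s e b)" for s e b
    by (cases s; cases e; cases b; auto)+
  moreover have "horizontal (shift x y w) = horizontal w" for w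
    by (cases w) auto
  moreover have "same_type u v \<longrightarrow> displacement (shift x y u) (shift x y v) =
      (1 * fst (displacement u v), 1 * snd (displacement u v))" for u v
    by (cases u; cases v) (auto simp: displacement_simps)
  ultimately show ?thesis
    unfolding symmetry_def by (metis zero_neq_one)
qed

lemma symmetry_flip_x: "symmetry flip_x flip_x_state"
proof -
  have "inj flip_x"
  proof (rule injI)
    fix u v assume "flip_x u = flip_x v"
    then show "u = v" by (cases u; cases v) auto
  qed
  moreover have "next_wall (flip_x_state s) e = flip_x (next_wall s e)"
    "move (flip_x_state s) e b = flip_x_state (move s e b)" for s e b
    by (cases s; cases e; cases b; auto)+
  moreover have "horizontal (flip_x w) = horizontal w" for w
    by (cases w) auto
  moreover have "same_type u v \<longrightarrow> displacement (flip_x u) (flip_x v) =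
      (- 1 * fst (displacement u v), 1 * snd (displacement u v))" for u v
    by (cases u; cases v) (auto simp: displacement_simps)
  moreover have "(-1::real) \<noteq> 0" by simp
  ultimately show ?thesis
    unfolding symmetry_def by (metis zero_neq_one)
qed

lemma symmetry_flip_y: "symmetry flip_y flip_y_state"
proof -
  have "inj flip_y"
  proof (rule injI)
    fix u v assume "flip_y u = flip_y v"
    then show "u = v" by (cases u; cases v) auto
  qed
  moreover have "next_wall (flip_y_state s) e = flip_y (next_wall s e)"
    "move (flip_y_state s) e b = flip_y_state (move s e b)" for s e b
    by (cases s; cases e; cases b; auto)+
  moreover have "horizontal (flip_y w) = horizontal w" for w
    by (cases w) auto
  moreover have "same_type u v \<longrightarrow> displacement (flip_y u) (flip_y v) =
      (1 * fst (displacement u v), - 1 * snd (displacement u v))" for u v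
    by (cases u; cases v) (auto simp: displacement_simps)
  moreover have "(-1::real) \<noteq> 0" by simp
  ultimately show ?thesis
    unfolding symmetry_def by (metis zero_neq_one)
qed

lemma symmetry_comp:
  assumes "symmetry f g" "symmetry f' g'"
  shows "symmetry (f \<circ> f') (g \<circ> g')"
proof -
  obtain \<alpha> \<beta> where nz: "\<alpha> \<noteq> 0" "\<beta> \<noteq> 0" and d: "\<And>x y. same_type x y \<Longrightarrow>
      displacement (f x) (f y) = (\<alpha> * fst (displacement x y), \<beta> * snd (displacement x y))"
    using assms(1) unfolding symmetry_def by blast
  obtain \<alpha>' \<beta>' where nz': "\<alpha>' \<noteq> 0" "\<beta>' \<noteq> 0" and d': "\<And>x y. same_type x y \<Longrightarrow>
      displacement (f' x) (f' y) = (\<alpha>' * fst (displacement x y), \<beta>' * snd (displacement x y))"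
    using assms(2) unfolding symmetry_def by blast
  have "horizontal (f' x) = horizontal x" for x
    using assms(2) unfolding symmetry_def by blast
  then have "\<forall>x y. same_type x y \<longrightarrow> displacement ((f \<circ> f') x) ((f \<circ> f') y) =
      ((\<alpha> * \<alpha>') * fst (displacement x y), (\<beta> * \<beta>') * snd (displacement x y))"
    by (simp add: d d' same_type_iff)
  moreover have "\<alpha> * \<alpha>' \<noteq> 0" "\<beta> * \<beta>' \<noteq> 0" using nz nz' by auto
  ultimately have "\<exists>\<alpha> \<beta>. \<alpha> \<noteq> 0 \<and> \<beta> \<noteq> 0 \<and> (\<forall>x y. same_type x y \<longrightarrow>
      displacement ((f \<circ> f') x) ((f \<circ> f') y) =
        (\<alpha> * fst (displacement x y), \<beta> * snd (displacement x y)))"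
    by blast
  moreover have "inj (f \<circ> f')"
    using assms unfolding symmetry_def by (intro inj_compose) blast+
  moreover have "(\<forall>s e. next_wall ((g \<circ> g') s) e = (f \<circ> f') (next_wall s e)) \<and>
      (\<forall>s e b. move ((g \<circ> g') s) e b = (g \<circ> g') (move s e b)) \<and>
      (\<forall>x. horizontal ((f \<circ> f') x) = horizontal x)"
    using assms unfolding symmetry_def by (simp only: comp_apply simp_thms)
  ultimately show ?thesis
    unfolding symmetry_def by blast
qed

text \<open>\<open>f\<close> takes a local frame to the actual grid, and \<open>height x\<close> is
  measured in the local frame. Walls below \<open>h\<close> are not compared, so older rows may
  contain anything.\<close>

definition agree :: "(wall \<Rightarrow> wall) \<Rightarrow> int \<Rightarrow> wall list \<Rightarrow> wall list \<Rightarrow> bool" where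
  "agree f h ws hs \<longleftrightarrow> (\<forall>x. height x \<ge> h \<longrightarrow> (f x \<in> set hs \<longleftrightarrow> x \<in> set ws))"

lemma exec_extends: "\<exists>zs. snd (fold cross es c) = snd c @ zs"
proof (induction es arbitrary: c)
  case (Cons e es)
  obtain zs where "snd (fold cross es (cross e c)) = snd (cross e c) @ zs"
    using Cons.IH by blast
  moreover have "snd (cross e c) = snd c \<or> snd (cross e c) = snd c @ [next_wall (fst c) e]"
    by (simp add: cross_def Let_def)
  ultimately show ?case by auto
qed simp

text \<open>
  This transfers a computation with a concrete list of erased walls to all symmetric images
  of it and to any further erased walls below height \<open>h\<close>.
\<close>

lemma exec_symmetry:
  assumes sym: "symmetry f g"
  shows "agree f h ws hs \<Longrightarrow> list_all (\<lambda>x. height x \<ge> h) (walls_met es (s, ws)) \<Longrightarrow>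
    fold cross es (s, ws) = (s', ws @ new) \<Longrightarrow>
    fold cross es (g s, hs) = (g s', hs @ map f new) \<and> agree f h (ws @ new) (hs @ map f new)"
proof (induction es arbitrary: s ws hs new)
  case Nil
  then show ?case by simp
next
  case (Cons e es)
  define x where "x = next_wall s e"
  have fx: "next_wall (g s) e = f x" and mv: "\<And>b. move (g s) e b = g (move s e b)"
    and inj: "inj f"
    using sym unfolding symmetry_def x_def by blast+
  have hx: "height x \<ge> h" using Cons.prems(2) by (simp add: x_def)
  then have iff: "f x \<in> set hs \<longleftrightarrow> x \<in> set ws" using Cons.prems(1) by (simp add: agree_def)
  show ?case
  proof (cases "x \<in> set ws")
    case True
    then have c: "cross e (s, ws) = (move s e False, ws)"
      "cross e (g s, hs) = (g (move s e False), hs)"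
      using iff by (auto simp: cross_def fx mv x_def[symmetric])
    then show ?thesis
      using Cons.IH[of ws hs "move s e False" new] Cons.prems by simp
  next
    case False
    then have c: "cross e (s, ws) = (move s e True, ws @ [x])"
      "cross e (g s, hs) = (g (move s e True), hs @ [f x])"
      using iff by (auto simp: cross_def fx mv x_def[symmetric])
    \<comment> \<open>The list only grows at its end, so \<open>x\<close> must be the first entry of
      \<open>new\<close>.\<close>
    from Cons.prems(3) c have eq: "fold cross es (move s e True, ws @ [x]) = (s', ws @ new)"
      by simp
    then obtain zs where zs: "ws @ new = (ws @ [x]) @ zs"
      using exec_extends[of es "(move s e True, ws @ [x])"] by auto
    then have new: "new = x # zs" by simp
    have ag: "agree f h (ws @ [x]) (hs @ [f x])"
      using Cons.prems(1) inj by (auto simp: agree_def inj_eq)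
    have "fold cross es (g (move s e True), hs @ [f x]) = (g s', (hs @ [f x]) @ map f zs) \<and>
      agree f h ((ws @ [x]) @ zs) ((hs @ [f x]) @ map f zs)"
      by (rule Cons.IH[OF ag]) (use Cons.prems(2) eq c new in auto)
    then show ?thesis using c new by simp
  qed
qed

section \<open>Event words of a regular row and of a turn\<close>

definition entry :: state where
  "entry = (0, 0, True, True)"

definition block :: "bool list" where
  "block = [True, True, True, False]"

definition long_block :: "bool list" where
  "long_block = [True, True, True, True, False]"

definition row_hits :: "wall list" where
  "row_hits = [Vertical 1 0, Vertical 0 0, Horizontal 1 1, Vertical 2 0,
     Horizontal (- 1) 0, Vertical (- 1) 0]"

text \<open>
  The erased walls at heights \<open>\<ge> -1\<close> when the particle enters the cell (0, 0) from
  a regular row; those of height \<open>-1\<close> are the walls erased in that row and the gap through which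
  it was entered.
\<close>

definition row_below :: "wall list" where
  "row_below = [Horizontal 0 0, Vertical (- 2) (- 1), Vertical (- 1) (- 1), Vertical 0 (- 1),
     Vertical 1 (- 1), Horizontal (- 1) (- 1), Horizontal (- 2) (- 1)]"

definition row_word :: "bool list" where
  "row_word = block @ block @ block"

text \<open>A finite simulation, settled by evaluation. All walls met have height at least 0, which
  later makes the outcome independent of the erasures in lower rows.\<close>

lemma row_exec:
  "fold cross row_word (entry, [Horizontal 0 0]) = (shift_state 1 1 entry, [Horizontal 0 0] @ row_hits)"
  "list_all (\<lambda>x. height x \<ge> 0) (walls_met row_word (entry, [Horizontal 0 0]))"
  unfolding row_word_def block_def entry_def row_hits_def
  by code_simp+

text \<open>The long block is the one reached with \<open>a < \<epsilon>\<close>, where \<open>i = \<lfloor>a / \<epsilon>\<rfloor>\<close> at the entry.\<close>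

definition turn_word :: "nat \<Rightarrow> bool list" where
  "turn_word i = concat (replicate i block) @ long_block @ concat (replicate (13 - i) block)"

text \<open>The position of the long block only permutes the first six hits, which are always the
  walls of \<open>row_hits\<close>; the other fourteen are common to all cases.\<close>

definition turn_hits :: "nat \<Rightarrow> wall list" where
  "turn_hits i =
     [Vertical 1 0, Vertical 0 0] @
     (if i = 0 then [Vertical 2 0, Horizontal 1 1, Vertical (-1) 0, Horizontal (-1) 0]
      else if i = 1 then [Horizontal 1 1, Vertical 2 0, Vertical (-1) 0, Horizontal (-1) 0]
      else [Horizontal 1 1, Vertical 2 0, Horizontal (-1) 0, Vertical (-1) 0]) @
     [Horizontal 2 1, Vertical 3 0, Horizontal (-3) (-1), Vertical (-3) (-1), Vertical 3 1,
      Vertical 2 1, Horizontal 3 2, Vertical 4 1, Horizontal (-2) 0, Vertical (-2) 0,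
      Horizontal 0 1, Horizontal 3 0, Vertical 4 0, Vertical 1 1]"

lemma less_three: "i < 3 \<longleftrightarrow> i = 0 \<or> i = 1 \<or> i = (2::nat)" by auto

text \<open>The excursion goes back one row, hence the bound -1 and the need for
  \<open>row_below\<close>. The only wall hit at height 2 or more is \<open>Horizontal 3 2\<close>,
  so the row entered at the end is untouched apart from its gap.\<close>

lemma turn_exec:
  assumes "i < 3"
  shows "fold cross (turn_word i) (entry, row_below) = (shift_state 3 2 entry, row_below @ turn_hits i)"
  "list_all (\<lambda>x. height x \<ge> -1) (walls_met (turn_word i) (entry, row_below))"
  using assms unfolding less_three
  by (elim disjE; simp only:;
      unfold turn_word_def block_def long_block_def entry_def row_below_def turn_hits_def; code_simp)+

section \<open>Timing of the grid line crossings\<close>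

text \<open>
  In \<open>(a, b, c)\<close> the times until the next vertical and horizontal grid line are \<open>a\<close> and \<open>b\<close>.
\<close>

definition step :: "real \<Rightarrow> real \<times> real \<times> state \<times> wall list \<Rightarrow> real \<times> real \<times> state \<times> wall list" where
  "step T = (\<lambda>(a, b, c). if a < b then (1, b - a, cross True c) else (a - b, T, cross False c))"

text \<open>The order of events depends on the two clocks alone, not on cells or walls; hence the
  quantifier over \<open>c\<close>, which separates timing from combinatorics.\<close>

definition leads :: "real \<Rightarrow> bool list \<Rightarrow> real \<Rightarrow> real \<Rightarrow> bool" where
  "leads T es a a' \<longleftrightarrow> (\<forall>c. (step T ^^ length es) (a, T, c) = (a', T, fold cross es c))"

lemma leads_append:
  assumes "leads T es a a'" "leads T es' a' a''"
  shows "leads T (es @ es') a a''"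
  unfolding leads_def
proof
  fix c
  have "(step T ^^ length (es @ es')) (a, T, c) =
      (step T ^^ length es') ((step T ^^ length es) (a, T, c))"
    by (simp only: length_append add.commute[of "length es"] funpow_add comp_apply)
  also have "(step T ^^ length es) (a, T, c) = (a', T, fold cross es c)"
    using assms(1) unfolding leads_def by blast
  also have "(step T ^^ length es') (a', T, fold cross es c) = (a'', T, fold cross es' (fold cross es c))"
    using assms(2) unfolding leads_def by blast
  finally show "(step T ^^ length (es @ es')) (a, T, c) = (a'', T, fold cross (es @ es') c)"
    by simp
qed

text \<open>Vertical lines come at times \<open>a\<close>, \<open>a + 1\<close>,
  \<open>a + 2\<close>, \<open>a + 3\<close>, and the horizontal one at
  \<open>3 + \<epsilon>\<close> lies strictly between the last two of these.\<close>

lemma leads_block: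
  assumes "T = 3 + \<epsilon>" "0 < \<epsilon>" "\<epsilon> < a" "a \<le> 1"
  shows "leads T block a (a - \<epsilon>)"
  using assms unfolding leads_def block_def
  by (auto simp: step_def eval_nat_numeral)

lemma leads_long_block:
  assumes "T = 3 + \<epsilon>" "\<epsilon> < 1" "0 < a" "a < \<epsilon>"
  shows "leads T long_block a (a + 1 - \<epsilon>)"
  using assms unfolding leads_def long_block_def
  by (auto simp: step_def eval_nat_numeral)

lemma leads_blocks:
  assumes "T = 3 + \<epsilon>" "0 < \<epsilon>" "k * \<epsilon> < a" "a \<le> 1"
  shows "leads T (concat (replicate k block)) a (a - k * \<epsilon>)"
  using assms(3,4)
proof (induction k arbitrary: a)
  case 0
  then show ?case by (simp add: leads_def)
next
  case (Suc k)
  have "0 \<le> k * \<epsilon>" using assms(2) by simp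
  then have "\<epsilon> < a" using Suc.prems by (simp add: algebra_simps)
  then have "leads T block a (a - \<epsilon>)"
    using leads_block assms(1,2) Suc.prems by blast
  moreover have "leads T (concat (replicate k block)) (a - \<epsilon>) (a - \<epsilon> - k * \<epsilon>)"
    using Suc.prems assms(2) by (intro Suc.IH) (auto simp: algebra_simps)
  ultimately show ?case
    using leads_append by (fastforce simp: algebra_simps)
qed

lemma leads_row:
  assumes "T = 3 + \<epsilon>" "0 < \<epsilon>" "3 * \<epsilon> < a" "a \<le> 1"
  shows "leads T row_word a (a - 3 * \<epsilon>)"
  using leads_blocks[of T \<epsilon> 3 a] assms by (simp add: row_word_def eval_nat_numeral)

text \<open>After \<open>i\<close> blocks the residue is below \<epsilon>, the long block raises it
  by \<open>1 - \<epsilon>\<close>, and \<open>13 - i\<close> further blocks follow. Every one of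
  the 14 blocks costs \<epsilon>, and the extra vertical line gains 1.\<close>

lemma leads_turn:
  assumes "T = 3 + \<epsilon>" "14 * \<epsilon> < 1" "i < 3" "i * \<epsilon> < a" "a < (i + 1) * \<epsilon>"
  shows "leads T (turn_word i) a (a + 1 - 14 * \<epsilon>)"
proof -
  have "0 < \<epsilon>" using assms(4,5) by (simp add: algebra_simps)
  have "(i + 1) * \<epsilon> \<le> 3 * \<epsilon>" using assms(3) \<open>0 < \<epsilon>\<close> by (intro mult_right_mono) auto
  then have "a \<le> 1" using assms \<open>0 < \<epsilon>\<close> by linarith
  then have 1: "leads T (concat (replicate i block)) a (a - i * \<epsilon>)"
    using leads_blocks[of T \<epsilon> i a] assms \<open>0 < \<epsilon>\<close> by simp
  have 2: "leads T long_block (a - i * \<epsilon>) (a - i * \<epsilon> + 1 - \<epsilon>)"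
    using assms \<open>0 < \<epsilon>\<close> by (intro leads_long_block) (auto simp: algebra_simps)
  have 3: "leads T (concat (replicate (13 - i) block)) (a - i * \<epsilon> + 1 - \<epsilon>)
      (a - i * \<epsilon> + 1 - \<epsilon> - real (13 - i) * \<epsilon>)"
  proof (rule leads_blocks)
    have "0 \<le> real i * \<epsilon>" using \<open>0 < \<epsilon>\<close> by simp
    then have "0 < a" using assms(4) by linarith
    have "real (13 - i) * \<epsilon> \<le> 13 * \<epsilon>" using \<open>0 < \<epsilon>\<close> by (intro mult_right_mono) auto
    then show "real (13 - i) * \<epsilon> < a - i * \<epsilon> + 1 - \<epsilon>" using assms by linarith
    show "a - i * \<epsilon> + 1 - \<epsilon> \<le> 1" using assms(5) by (simp add: algebra_simps)
  qed (use assms \<open>0 < \<epsilon>\<close> in auto)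
  have "a - i * \<epsilon> + 1 - \<epsilon> - real (13 - i) * \<epsilon> = a + 1 - 14 * \<epsilon>"
    using assms(3) by (simp add: of_nat_diff algebra_simps)
  with 3 have 3: "leads T (concat (replicate (13 - i) block)) (a - i * \<epsilon> + 1 - \<epsilon>) (a + 1 - 14 * \<epsilon>)"
    by simp
  show ?thesis
    using leads_append[OF 1 leads_append[OF 2 3]] by (simp add: turn_word_def)
qed

section \<open>Geometry of the particle\<close>

text \<open>With horizontal speed 1 and vertical speed \<open>s\<close>, the clocks \<open>a\<close>
  and \<open>b\<close> give the distances \<open>a\<close> and \<open>s * b\<close> to the grid
  lines ahead, on the side that the flags indicate.\<close>

fun position :: "real \<Rightarrow> real \<times> real \<times> state \<times> wall list \<Rightarrow> point" where
  "position s (a, b, (i, j, right, up), hs) =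
     (if right then i + 1 - a else i + a, if up then j + 1 - s * b else j + s * b)"

fun velocity :: "real \<Rightarrow> state \<Rightarrow> point" where
  "velocity s (i, j, right, up) = (if right then 1 else -1, if up then s else - s)"

lemma mem_wall_points:
  "(x, y) \<in> wall_points (Horizontal i j) \<longleftrightarrow> y = j \<and> i \<le> x \<and> x \<le> i + 1"
  "(x, y) \<in> wall_points (Vertical i j) \<longleftrightarrow> x = i \<and> j \<le> y \<and> y \<le> j + 1"
proof -
  have 1: "\<exists>u. 0 \<le> u \<and> u \<le> 1 \<and> z = k + u" if "k \<le> z" "z \<le> k + 1" for z k :: real
    using that by (intro exI[of _ "z - k"]) auto
  show "(x, y) \<in> wall_points (Horizontal i j) \<longleftrightarrow> y = j \<and> i \<le> x \<and> x \<le> i + 1"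
    using 1[of i x] by (auto simp: closed_segment_def algebra_simps)
  show "(x, y) \<in> wall_points (Vertical i j) \<longleftrightarrow> x = i \<and> j \<le> y \<and> y \<le> j + 1"
    using 1[of j y] by (auto simp: closed_segment_def algebra_simps)
qed

declare wall_points.simps [simp del]

text \<open>The last condition says that no corner is ever met.\<close>

definition in_range :: "real \<Rightarrow> real \<times> real \<times> state \<times> wall list \<Rightarrow> bool" where
  "in_range T = (\<lambda>(a, b, c). 0 < a \<and> a \<le> 1 \<and> 0 < b \<and> b \<le> T \<and> (\<forall>u v. a - b \<noteq> of_int u + of_int v * T))"

text \<open>A step changes \<open>a - b\<close> by 1 or by \<open>- T\<close>, so its class modulo
  the group generated by 1 and \<open>T\<close> is invariant. A corner would need
  \<open>a = b\<close>, the zero class.\<close>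

lemma in_range_step:
  assumes "in_range T x"
  shows "in_range T (step T x)"
proof -
  obtain a b c where x: "x = (a, b, c)" by (cases x) auto
  have r: "0 < a" "a \<le> 1" "0 < b" "b \<le> T" and nz: "\<And>u v. a - b \<noteq> of_int u + of_int v * T"
    using assms by (auto simp: in_range_def x)
  have "a \<noteq> b" using nz[of 0 0] by auto
  have 1: "1 - (b - a) \<noteq> of_int u + of_int v * T" for u v
    using nz[of "u - 1" v] by (auto simp: algebra_simps)
  have 2: "a - b - T \<noteq> of_int u + of_int v * T" for u v
    using nz[of u "v + 1"] by (auto simp: algebra_simps)
  show ?thesis
    using r 1 2 \<open>a \<noteq> b\<close> by (auto simp: in_range_def x step_def)
qed

definition vertical_next :: "real \<times> real \<times> state \<times> wall list \<Rightarrow> bool" where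
  "vertical_next = (\<lambda>(a, b, c). a < b)"

definition state_of :: "real \<times> real \<times> state \<times> wall list \<Rightarrow> state" where
  "state_of = (\<lambda>(a, b, s, hs). s)"

definition hits :: "real \<times> real \<times> state \<times> wall list \<Rightarrow> wall list" where
  "hits = (\<lambda>(a, b, s, hs). hs)"

definition wall_ahead :: "real \<times> real \<times> state \<times> wall list \<Rightarrow> wall" where
  "wall_ahead x = next_wall (state_of x) (vertical_next x)"

lemma strictly_between_ints:
  fixes x :: real
  assumes "of_int i < x" "x < of_int i + 1"
  shows "x \<noteq> of_int k"
proof
  assume "x = of_int k"
  then have "real_of_int i < of_int k" "real_of_int k < of_int (i + 1)" using assms by auto
  then show False unfolding of_int_less_iff by simp
qed

lemma unit_interval_unique:
  fixes x :: real
  assumes "of_int i < x" "x < of_int i + 1"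
  shows "of_int m \<le> x \<and> x \<le> of_int m + 1 \<longleftrightarrow> m = i"
  using assms by linarith

text \<open>Until the first clock runs out the particle is inside an open unit cell; because
  \<open>a \<noteq> b\<close>, it then lies in the relative interior of a single wall.\<close>

lemma flight:
  assumes T: "0 < T" and x: "in_range T x"
  obtains d where "0 < d"
    "position (1 / T) (step T x) = position (1 / T) x + d *\<^sub>R velocity (1 / T) (state_of x)"
    "\<And>t. 0 < t \<Longrightarrow> t \<le> d \<Longrightarrow> position (1 / T) x + t *\<^sub>R velocity (1 / T) (state_of x) \<notin> corners"
    "\<And>t w. 0 < t \<Longrightarrow> t < d \<Longrightarrow>
       position (1 / T) x + t *\<^sub>R velocity (1 / T) (state_of x) \<notin> wall_points w"
    "\<And>w. position (1 / T) (step T x) \<in> wall_points w \<longleftrightarrow> w = wall_ahead x"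
proof -
  obtain a b i j right up hs where xx: "x = (a, b, (i, j, right, up), hs)"
    by (cases x) auto
  have r: "0 < a" "a \<le> 1" "0 < b" "b \<le> T" and nz: "\<And>u v. a - b \<noteq> of_int u + of_int v * T"
    using x by (auto simp: in_range_def xx)
  have "a \<noteq> b" using nz[of 0 0] by auto
  define s where "s = 1 / T"
  have s: "0 < s" "s * T = 1" using T by (auto simp: s_def)
  define p where "p = position s x"
  define v where "v = velocity s (state_of x)"
  define d where "d = min a b"
  have pt: "p + t *\<^sub>R v =
      (if right then i + 1 - (a - t) else i + (a - t),
       if up then j + 1 - s * (b - t) else j + s * (b - t))" for t
    by (auto simp: p_def v_def xx state_of_def algebra_simps)
  have yb: "0 < s * z \<and> s * z < 1" if "0 < z" "z < T" for z
    using that s mult_strict_left_mono[of z T s] by simp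
  have end_pt: "position s (step T x) = p + d *\<^sub>R v"
    unfolding pt using s by (auto simp: xx step_def d_def cross_def Let_def algebra_simps)
  have inner: "of_int i < fst (p + t *\<^sub>R v) \<and> fst (p + t *\<^sub>R v) < of_int i + 1 \<and>
      of_int j < snd (p + t *\<^sub>R v) \<and> snd (p + t *\<^sub>R v) < of_int j + 1" if "0 < t" "t < d" for t
    using that r yb[of "b - t"] unfolding pt d_def by auto
  have inner_wall: "p + t *\<^sub>R v \<notin> wall_points w" if t: "0 < t" "t < d" for t w
  proof -
    obtain X Y where XY: "p + t *\<^sub>R v = (X, Y)" by (cases "p + t *\<^sub>R v")
    show ?thesis
      using inner[OF t] strictly_between_ints unfolding XY
      by (cases w) (auto simp: mem_wall_points)
  qed
  have inner_corner: "p + t *\<^sub>R v \<notin> corners" if t: "0 < t" "t < d" for t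
    using inner[OF t] strictly_between_ints unfolding corners_def
    by (auto simp: mem_Times_iff Ints_def)
  have last: "(p + d *\<^sub>R v \<in> wall_points w \<longleftrightarrow> w = wall_ahead x) \<and> p + d *\<^sub>R v \<notin> corners" for w
  proof (cases "a < b")
    case True
    define k where "k = (if right then i + 1 else i)"
    define Y where "Y = (if up then j + 1 - s * (b - a) else j + s * (b - a))"
    have eq: "p + d *\<^sub>R v = (of_int k, Y)"
      using True unfolding pt d_def k_def Y_def by auto
    have Y: "of_int j < Y" "Y < of_int j + 1" using yb[of "b - a"] True r by (auto simp: Y_def)
    have ah: "wall_ahead x = Vertical k j"
      using True by (simp add: wall_ahead_def state_of_def vertical_next_def xx k_def)
    have "Y \<notin> \<int>" using Y strictly_between_ints by (auto simp: Ints_def)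
    moreover have "(of_int k, Y) \<in> wall_points w \<longleftrightarrow> w = Vertical k j"
      using strictly_between_ints[OF Y] unit_interval_unique[OF Y]
      by (cases w) (simp_all add: mem_wall_points, blast)
    ultimately show ?thesis unfolding eq ah corners_def by auto
  next
    case False
    then have ba: "b < a" using \<open>a \<noteq> b\<close> by auto
    define k where "k = (if up then j + 1 else j)"
    define X where "X = (if right then i + 1 - (a - b) else i + (a - b))"
    have eq: "p + d *\<^sub>R v = (X, of_int k)"
      using ba unfolding pt d_def k_def X_def by auto
    have X: "of_int i < X" "X < of_int i + 1" using ba r by (auto simp: X_def)
    have ah: "wall_ahead x = Horizontal i k"
      using False by (simp add: wall_ahead_def state_of_def vertical_next_def xx k_def)
    have "X \<notin> \<int>" using X strictly_between_ints by (auto simp: Ints_def)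
    moreover have "(X, of_int k) \<in> wall_points w \<longleftrightarrow> w = Horizontal i k"
      using strictly_between_ints[OF X] unit_interval_unique[OF X]
      by (cases w) (simp_all add: mem_wall_points, blast)
    ultimately show ?thesis unfolding eq ah corners_def by auto
  qed
  show thesis
  proof (rule that[of d])
    show "0 < d" using r by (simp add: d_def)
  qed (use end_pt inner_wall inner_corner last in \<open>auto simp: p_def v_def s_def order_le_less\<close>)
qed

lemma step_hits:
  "wall_ahead x \<in> set (hits x) \<Longrightarrow> hits (step T x) = hits x \<and>
     velocity s (state_of (step T x)) = velocity s (state_of x)"
  "wall_ahead x \<notin> set (hits x) \<Longrightarrow> hits (step T x) = hits x @ [wall_ahead x] \<and>
     velocity s (state_of (step T x)) = reflect (wall_ahead x) (velocity s (state_of x))"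
proof -
  obtain a b i j right up hs where xx: "x = (a, b, (i, j, right, up), hs)"
    by (cases x) auto
  have "(wall_ahead x \<in> set (hits x) \<longrightarrow> hits (step T x) = hits x \<and>
     velocity s (state_of (step T x)) = velocity s (state_of x)) \<and>
   (wall_ahead x \<notin> set (hits x) \<longrightarrow> hits (step T x) = hits x @ [wall_ahead x] \<and>
     velocity s (state_of (step T x)) = reflect (wall_ahead x) (velocity s (state_of x)))"
    unfolding xx step_def hits_def state_of_def wall_ahead_def vertical_next_def cross_def Let_def
    by (cases "a < b") simp_all
  then show "wall_ahead x \<in> set (hits x) \<Longrightarrow> hits (step T x) = hits x \<and>
     velocity s (state_of (step T x)) = velocity s (state_of x)"
    "wall_ahead x \<notin> set (hits x) \<Longrightarrow> hits (step T x) = hits x @ [wall_ahead x] \<and>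
     velocity s (state_of (step T x)) = reflect (wall_ahead x) (velocity s (state_of x))"
    by blast+
qed

lemma collides_now:
  assumes "0 < T" "in_range T x" "wall_ahead x \<in> S"
  shows "collides S (position (1 / T) x) (velocity (1 / T) (state_of x)) (wall_ahead x)
    (position (1 / T) (step T x))"
proof -
  from flight[OF assms(1,2)] obtain d where d: "0 < d"
    "position (1 / T) (step T x) = position (1 / T) x + d *\<^sub>R velocity (1 / T) (state_of x)"
    "\<And>t. 0 < t \<Longrightarrow> t \<le> d \<Longrightarrow> position (1 / T) x + t *\<^sub>R velocity (1 / T) (state_of x) \<notin> corners"
    "\<And>t w. 0 < t \<Longrightarrow> t < d \<Longrightarrow>
       position (1 / T) x + t *\<^sub>R velocity (1 / T) (state_of x) \<notin> wall_points w"
    "\<And>w. position (1 / T) (step T x) \<in> wall_points w \<longleftrightarrow> w = wall_ahead x"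
    by blast
  then show ?thesis
    unfolding collides_def using assms(3) by (intro conjI exI[of _ d]) auto
qed

text \<open>A flight that ends at an erased wall continues straight on, so it can be prepended to
  the next collision.\<close>

lemma collides_later:
  assumes "0 < T" "in_range T x" "wall_ahead x \<notin> S"
    and "collides S (position (1 / T) (step T x)) (velocity (1 / T) (state_of x)) w p'"
  shows "collides S (position (1 / T) x) (velocity (1 / T) (state_of x)) w p'"
proof -
  define p where "p = position (1 / T) x"
  define v where "v = velocity (1 / T) (state_of x)"
  from flight[OF assms(1,2)] obtain d where d: "0 < d"
    "position (1 / T) (step T x) = p + d *\<^sub>R v"
    "\<And>t. 0 < t \<Longrightarrow> t \<le> d \<Longrightarrow> p + t *\<^sub>R v \<notin> corners"
    "\<And>t w. 0 < t \<Longrightarrow> t < d \<Longrightarrow> p + t *\<^sub>R v \<notin> wall_points w"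
    "\<And>w. position (1 / T) (step T x) \<in> wall_points w \<longleftrightarrow> w = wall_ahead x"
    unfolding p_def v_def by blast
  obtain e where e: "e > 0" "w \<in> S" "p' = p + d *\<^sub>R v + e *\<^sub>R v" "p' \<in> wall_points w"
    "\<And>t. t \<in> {0<..e} \<Longrightarrow> p + d *\<^sub>R v + t *\<^sub>R v \<notin> corners"
    "\<And>t w. t \<in> {0<..<e} \<Longrightarrow> w \<in> S \<Longrightarrow> p + d *\<^sub>R v + t *\<^sub>R v \<notin> wall_points w"
    using assms(4) unfolding collides_def d(2) v_def[symmetric] by auto
  have sh: "p + d *\<^sub>R v + (t - d) *\<^sub>R v = p + t *\<^sub>R v" for t
    by (simp add: algebra_simps)
  have "p + t *\<^sub>R v \<notin> corners" if "0 < t" "t \<le> d + e" for t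
    using d(3)[of t] e(5)[of "t - d"] that by (cases "t \<le> d") (auto simp: sh)
  moreover have "p + t *\<^sub>R v \<notin> wall_points w" if "0 < t" "t < d + e" "w \<in> S" for t w
  proof -
    consider "t < d" | "t = d" | "d < t" by linarith
    then show ?thesis
    proof cases
      case 2
      then show ?thesis using d(2,5) assms(3) that(3) by metis
    next
      case 3
      then show ?thesis using e(6)[of "t - d" w] that by (auto simp: sh)
    qed (use d(4) that in blast)
  qed
  ultimately show ?thesis
    unfolding collides_def p_def[symmetric] v_def[symmetric] using e d(1)
    by (intro conjI exI[of _ "d + e"]) (auto simp: algebra_simps)
qed

text \<open>Used to pass from horizontal speed 1 to the unit speed of
  \<open>initial_direction\<close>.\<close>

lemma collides_scale:
  assumes "0 < c" "collides S p v w p'"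
  shows "collides S p (c *\<^sub>R v) w p'"
proof -
  obtain e where e: "e > 0" "w \<in> S" "p' = p + e *\<^sub>R v" "p' \<in> wall_points w"
    "\<And>t. t \<in> {0<..e} \<Longrightarrow> p + t *\<^sub>R v \<notin> corners"
    "\<And>t w. t \<in> {0<..<e} \<Longrightarrow> w \<in> S \<Longrightarrow> p + t *\<^sub>R v \<notin> wall_points w"
    using assms(2) unfolding collides_def by auto
  have "p + t *\<^sub>R c *\<^sub>R v \<notin> corners" if "0 < t" "t \<le> e / c" for t
    using e(5)[of "t * c"] that assms(1) by (auto simp: field_simps)
  moreover have "p + t *\<^sub>R c *\<^sub>R v \<notin> wall_points w" if "0 < t" "t < e / c" "w \<in> S" for t w
    using e(6)[of "t * c" w] that assms(1) by (auto simp: field_simps)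
  ultimately show ?thesis
    unfolding collides_def using e assms(1)
    by (intro conjI exI[of _ "e / c"]) auto
qed

section \<open>From orbits of the step map to trajectories\<close>

abbreviation orbit ::
  "real \<Rightarrow> real \<times> real \<times> state \<times> wall list \<Rightarrow> nat \<Rightarrow> real \<times> real \<times> state \<times> wall list" where
  "orbit T x k \<equiv> (step T ^^ k) x"

lemma in_range_orbit: "in_range T x \<Longrightarrow> in_range T (orbit T x k)"
  by (induction k) (auto intro: in_range_step)

lemma hits_orbit_extends:
  assumes "k \<le> l"
  shows "\<exists>zs. hits (orbit T x l) = hits (orbit T x k) @ zs"
  using assms
proof (induction l rule: dec_induct)
  case (step l)
  then obtain zs where "hits (orbit T x l) = hits (orbit T x k) @ zs" by blast
  then show ?case
    using step_hits[of "orbit T x l" T 0] by (cases "wall_ahead (orbit T x l) \<in> set (hits (orbit T x l))") auto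
qed simp

text \<open>Steps are crossings of grid lines, and only those at solid walls are collisions. Each
  collision is obtained by gluing the flights since the previous one.\<close>

lemma orbit_runs_forever:
  assumes T: "0 < T" and x: "in_range T x" "hits x = []"
    and inf: "\<And>n. \<exists>k. n < length (hits (orbit T x k))"
    and s: "0 < c" "initial_direction s = c *\<^sub>R velocity (1 / T) (state_of x)"
  obtains q w where "runs_forever (position (1 / T) x) s q w"
    "\<And>n k. n < length (hits (orbit T x k)) \<Longrightarrow> w n = hits (orbit T x k) ! n"
proof -
  define X where "X = orbit T x"
  define L where "L k = length (hits (X k))" for k
  \<comment> \<open>Step number \<open>h n\<close> is the one that performs collision
    \<open>n\<close>.\<close>
  define h where "h n = (LEAST k. n < L (Suc k))" for n
  define w where "w n = wall_ahead (X (h n))" for n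
  \<comment> \<open>The straight path leading to collision \<open>n\<close> begins just after the
    previous collision, or at step 0.\<close>
  define g where "g n = (case n of 0 \<Rightarrow> 0 | Suc m \<Rightarrow> Suc (h m))" for n
  define pos where "pos k = position (1 / T) (X k)" for k
  define vel where "vel k = velocity (1 / T) (state_of (X k))" for k
  have X_Suc: "X (Suc k) = step T (X k)" for k by (simp add: X_def)
  have range: "in_range T (X k)" for k using in_range_orbit x(1) by (simp add: X_def)
  have ext: "\<exists>zs. hits (X l) = hits (X k) @ zs" if "k \<le> l" for k l
    using hits_orbit_extends that by (simp add: X_def)
  have mono: "L k \<le> L l" if "k \<le> l" for k l
    using ext[OF that] by (auto simp: L_def)
  have L0: "L 0 = 0" by (simp add: L_def X_def x)
  have pass: "hits (X (Suc k)) = hits (X k) \<and> vel (Suc k) = vel k"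
    if "wall_ahead (X k) \<in> set (hits (X k))" for k
    using step_hits(1)[OF that] by (simp add: X_Suc vel_def)
  have hit: "hits (X (Suc k)) = hits (X k) @ [wall_ahead (X k)] \<and>
      vel (Suc k) = reflect (wall_ahead (X k)) (vel k)"
    if "wall_ahead (X k) \<notin> set (hits (X k))" for k
    using step_hits(2)[OF that] by (simp add: X_Suc vel_def)
  have L_Suc: "L (Suc k) = L k \<longleftrightarrow> wall_ahead (X k) \<in> set (hits (X k))"
    "L (Suc k) \<le> Suc (L k)" for k
    using pass[of k] hit[of k] by (cases "wall_ahead (X k) \<in> set (hits (X k))"; auto simp: L_def)+
  have h1: "n < L (Suc (h n))" for n
  proof -
    obtain k where "n < L k" using inf[of n] by (auto simp: L_def X_def)
    then obtain l where "n < L (Suc l)" using L0 by (cases k) auto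
    then show ?thesis unfolding h_def by (rule LeastI)
  qed
  \<comment> \<open>One step adds at most one hit, so exactly \<open>n\<close> hits precede
    collision \<open>n\<close>.\<close>
  have h2: "L (h n) = n" for n
  proof -
    have "L (h n) \<le> n"
    proof (cases "h n")
      case 0
      then show ?thesis using L0 by simp
    next
      case (Suc k)
      then have "k < h n" by simp
      then show ?thesis using not_less_Least[of k "\<lambda>k. n < L (Suc k)"] Suc by (simp add: h_def)
    qed
    moreover have "n \<le> L (h n)" using h1[of n] L_Suc(2)[of "h n"] by linarith
    ultimately show ?thesis by simp
  qed
  have solid: "wall_ahead (X (h n)) \<notin> set (hits (X (h n)))" for n
    using h1[of n] h2[of n] L_Suc(1)[of "h n"] by auto
  have nth: "w n = hits (X k) ! n" if "n < L k" for n k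
  proof -
    have "Suc (h n) \<le> k" using that mono[of k "h n"] h2[of n] by (cases "k \<le> h n") auto
    then obtain zs where "hits (X k) = (hits (X (h n)) @ [w n]) @ zs"
      using ext hit[OF solid[of n]] w_def by metis
    then show ?thesis using h2[of n] by (simp add: L_def nth_append)
  qed
  have image: "w ` {..<L k} = set (hits (X k))" for k
  proof -
    have "hits (X k) = map w [0..<L k]"
      by (rule nth_equalityI) (auto simp: L_def[symmetric] nth)
    then have "set (hits (X k)) = set (map w [0..<L k])" by simp
    then show ?thesis by (auto simp: atLeast0LessThan)
  qed
  have Lg: "L (g n) = n" for n
  proof (cases n)
    case (Suc m)
    then show ?thesis using h1[of m] h2[of m] L_Suc(2)[of "h m"] by (simp add: g_def)
  qed (simp add: g_def L0)
  have gh: "g n \<le> h n" for n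
  proof (rule ccontr)
    assume "\<not> g n \<le> h n"
    then have "L (Suc (h n)) \<le> L (g n)" by (intro mono) simp
    then show False using h1[of n] Lg[of n] by simp
  qed
  \<comment> \<open>Induction downwards from the collision at \<open>h n\<close> to the start at
    \<open>g n\<close>; every earlier wall on the way is already erased.\<close>
  have flight: "collides (UNIV - w ` {..<n}) (pos k) (vel k) (w n) (pos (Suc (h n))) \<and> vel k = vel (h n)"
    if "k \<le> h n" "g n \<le> k" for k n
    using that
  proof (induction k rule: inc_induct)
    case base
    have "w n \<notin> w ` {..<n}" using image[of "h n"] h2[of n] solid[of n] by (simp add: w_def)
    then show ?case
      using collides_now[OF T range, of "h n" "UNIV - w ` {..<n}"]
      by (simp add: pos_def vel_def w_def X_Suc)
  next
    case (step k)
    have "L k = n" "L (Suc k) = n"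
      using step mono[of "g n" k] mono[of k "h n"] mono[of k "Suc k"] mono[of "Suc k" "h n"] Lg[of n] h2[of n]
      by auto
    then have in_hits: "wall_ahead (X k) \<in> set (hits (X k))" and im: "w ` {..<n} = set (hits (X k))"
      using L_Suc(1)[of k] image[of k] by simp_all
    have v: "vel (Suc k) = vel k" using pass[OF in_hits] by simp
    have IH: "collides (UNIV - w ` {..<n}) (pos (Suc k)) (vel (Suc k)) (w n) (pos (Suc (h n)))"
      "vel (Suc k) = vel (h n)"
      using step.IH step.prems by auto
    have "collides (UNIV - w ` {..<n}) (pos k) (vel k) (w n) (pos (Suc (h n)))"
      unfolding pos_def[of k] vel_def[of k]
      by (rule collides_later[OF T range]) (use in_hits im IH(1) v in \<open>simp_all add: pos_def vel_def X_Suc\<close>)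
    then show ?case using v IH(2) by simp
  qed
  define q where "q n = pos (g n)" for n
  have "runs_forever (position (1 / T) x) s q w"
    unfolding runs_forever_def
  proof (intro conjI exI[of _ "\<lambda>n. c *\<^sub>R vel (g n)"] allI)
    show "q 0 = position (1 / T) x" by (simp add: q_def g_def pos_def X_def)
    show "c *\<^sub>R vel (g 0) = initial_direction s" by (simp add: g_def vel_def X_def s)
    fix n
    have q_Suc: "q (Suc n) = pos (Suc (h n))" by (simp add: q_def g_def)
    show "collides (UNIV - w ` {..<n}) (q n) (c *\<^sub>R vel (g n)) (w n) (q (Suc n))"
      unfolding q_Suc q_def[of n] using flight[of "g n" n] gh[of n] s(1) by (intro collides_scale) auto
    have "vel (g (Suc n)) = reflect (w n) (vel (g n))"
      using hit[OF solid[of n]] flight[of "g n" n] gh[of n] by (simp add: g_def w_def)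
    moreover have "reflect y (c *\<^sub>R v) = c *\<^sub>R reflect y v" for y v
      by (cases y; cases v) auto
    ultimately show "c *\<^sub>R vel (g (Suc n)) = reflect (w n) (c *\<^sub>R vel (g n))" by simp
  qed
  moreover have "w n = hits (orbit T x k) ! n" if "n < length (hits (orbit T x k))" for n k
    using nth[of n k] that by (simp add: L_def X_def)
  ultimately show thesis by (rule that)
qed

section \<open>Drifting walls and the period\<close>

lemma dist_end_point:
  assumes "x \<in> wall_points w"
  shows "dist x (end_point w) \<le> 1"
proof -
  obtain a b where x: "x = (a, b)" by (cases x)
  show ?thesis
    using assms unfolding x
    by (cases w) (auto simp: mem_wall_points dist_Pair_Pair dist_real_def)
qed

lemma runs_forever_wall:
  assumes "runs_forever P s q w"
  shows "q (Suc n) \<in> wall_points (w n)"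
  using assms unfolding runs_forever_def collides_def by blast

lemma drift_end_point:
  assumes "\<And>n. n \<ge> n0 \<Longrightarrow> displacement (w n) (w (n + \<kappa>)) = D"
  shows "end_point (w (n0 + r + p * \<kappa>)) = end_point (w (n0 + r)) + real p *\<^sub>R D"
proof (induction p)
  case (Suc p)
  have "end_point (w (n0 + r + p * \<kappa> + \<kappa>)) = D + end_point (w (n0 + r + p * \<kappa>))"
    using assms[of "n0 + r + p * \<kappa>"] unfolding displacement_def by (simp add: algebra_simps)
  moreover have "n0 + r + p * \<kappa> + \<kappa> = n0 + r + Suc p * \<kappa>" by simp
  ultimately have "end_point (w (n0 + r + Suc p * \<kappa>)) = D + end_point (w (n0 + r + p * \<kappa>))" by simp
  then show ?case unfolding Suc.IH by (simp add: algebra_simps)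
qed simp

lemma index_split:
  assumes "\<kappa> > 0" "n0 \<le> (n::nat)"
  obtains r p where "r < \<kappa>" "n = n0 + r + p * \<kappa>" "p = (n - n0) div \<kappa>"
proof (rule that[of "(n - n0) mod \<kappa>" "(n - n0) div \<kappa>"])
  show "n = n0 + (n - n0) mod \<kappa> + (n - n0) div \<kappa> * \<kappa>"
    using assms mod_div_mult_eq[of "n - n0" \<kappa>] by linarith
qed (use assms in auto)

text \<open>A constant drift keeps all late walls close to the ray from the origin in direction
  \<open>D\<close>, so one band suffices. As the collisions go off to infinity, any admissible
  period also makes the wall types eventually periodic, which \<open>aperiodic\<close> excludes up
  to \<open>N\<close>.\<close>

lemma drift_tunnels:
  assumes run: "runs_forever P s q w"
    and "\<kappa> > 0" "D \<noteq> 0"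
    and same: "\<And>n. n \<ge> n0 \<Longrightarrow> same_type (w n) (w (n + \<kappa>))"
    and drift1: "\<And>n. n \<ge> n0 \<Longrightarrow> displacement (w n) (w (n + \<kappa>)) = D"
    and aperiodic: "\<And>k n1. 0 < k \<Longrightarrow> k \<le> N \<Longrightarrow> \<exists>n\<ge>n1. \<not> same_type (w n) (w (n + k))"
  shows "tunnels_periodically P s q w \<and> period q w > N"
proof -
  define E where "E = (\<Sum>r<\<kappa>. norm (end_point (w (n0 + r))))"
  define u where "u = (1 / norm D) *\<^sub>R D"
  \<comment> \<open>\<open>E\<close> bounds the end points in one period of collisions; the
    additional 1 is the length of a wall.\<close>
  define B :: "band_data set" where "B = {(0, u, E + 1)}"
  \<comment> \<open>Outside a disc of radius at least \<open>R\<close> only collisions with index at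
    least \<open>n0\<close> remain.\<close>
  define R where "R = (\<Sum>n<n0. norm (q (Suc n)))"
  have D: "norm D > 0" using \<open>D \<noteq> 0\<close> by simp
  have E: "norm (end_point (w (n0 + r))) \<le> E" if "r < \<kappa>" for r
    unfolding E_def using that by (intro member_le_sum) auto
  have E0: "E \<ge> 0" unfolding E_def by (intro sum_nonneg) auto
  have drift: "end_point (w (n0 + r + p * \<kappa>)) = end_point (w (n0 + r)) + real p *\<^sub>R D" for r p
    using drift1 by (rule drift_end_point)
  have near: "dist x (real p *\<^sub>R D) \<le> E + 1"
    if "r < \<kappa>" "x \<in> wall_points (w (n0 + r + p * \<kappa>))" for x r p
  proof -
    have "dist x (real p *\<^sub>R D) \<le> dist x (end_point (w (n0 + r + p * \<kappa>))) +
        dist (end_point (w (n0 + r + p * \<kappa>))) (real p *\<^sub>R D)"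
      by (rule dist_triangle)
    also have "dist (end_point (w (n0 + r + p * \<kappa>))) (real p *\<^sub>R D) = norm (end_point (w (n0 + r)))"
      unfolding drift by (simp add: dist_norm)
    finally show ?thesis using E[OF that(1)] dist_end_point[OF that(2)] by simp
  qed
  have band: "wall_points (w n) \<subseteq> band_points (0, u, E + 1)" if n: "n \<ge> n0" for n
  proof
    fix x assume x: "x \<in> wall_points (w n)"
    obtain r p where rp: "r < \<kappa>" "n = n0 + r + p * \<kappa>"
      using index_split[OF \<open>\<kappa> > 0\<close> n] by metis
    have "dist x (real p *\<^sub>R D) \<le> E + 1" using near rp x by blast
    moreover have "real p *\<^sub>R D = 0 + (real p * norm D) *\<^sub>R u" using D by (simp add: u_def)
    ultimately show "x \<in> band_points (0, u, E + 1)"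
      unfolding band_points.simps using D by (intro CollectI exI[of _ "real p * norm D"]) auto
  qed
  have fin: "finite_bands B" using D E0 by (simp add: finite_bands_def B_def u_def)
  have out: "n \<ge> n0" if "n \<in> outside_disc r q" "r \<ge> R" for n r
  proof (rule ccontr)
    assume "\<not> n0 \<le> n"
    then have "norm (q (Suc n)) \<le> R" unfolding R_def by (intro member_le_sum) auto
    then show False using that by (simp add: outside_disc_def)
  qed
  have in_band: "\<forall>r\<ge>R. \<forall>n\<in>outside_disc r q. \<exists>b\<in>B. wall_points (w n) \<subseteq> band_points b"
    using band out unfolding B_def by blast
  have bands: "tunnel_bands q w B"
    unfolding tunnel_bands_def eventually_at_top_linorder
    using fin in_band by (intro conjI) (auto simp: B_def simp del: band_points.simps)
  have rep: "repeats q w B r \<kappa>" if "r \<ge> R" for r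
    unfolding repeats_def using \<open>\<kappa> > 0\<close> same drift1 out that by (intro conjI exI[of _ "\<lambda>_. D"]) auto
  have ev: "\<forall>\<^sub>F r in at_top. repeats q w B r \<kappa>"
    using rep unfolding eventually_at_top_linorder by blast
  have "tunnels P s q w"
    unfolding tunnels_def using run fin in_band by blast
  moreover have "\<forall>\<^sub>F r in at_top. \<exists>k. repeats q w B r k"
    using ev by eventually_elim blast
  ultimately have tp: "tunnels_periodically P s q w"
    unfolding tunnels_periodically_def using bands by blast
  have "\<exists>B. tunnel_bands q w B \<and> (\<forall>\<^sub>F r in at_top. repeats q w B r (period q w))"
    unfolding period_def by (rule LeastI[of _ \<kappa>]) (use bands ev in blast)
  then obtain B' r where r: "repeats q w B' r (period q w)"
    unfolding eventually_at_top_linorder by blast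
  \<comment> \<open>After \<open>m\<close> drifts the collision points have left the disc of radius
    \<open>r\<close>, even allowing for the deviation \<open>E + 1\<close> from the ray.\<close>
  obtain m :: nat where m: "r + E + 1 < m * norm D"
    using D reals_Archimedean3[of "norm D"] by blast
  have far: "n \<in> outside_disc r q" if n: "n \<ge> n0 + m * \<kappa>" for n
  proof -
    have "n \<ge> n0" using n by simp
    then obtain l p where lp: "l < \<kappa>" "n = n0 + l + p * \<kappa>" "p = (n - n0) div \<kappa>"
      using index_split[OF \<open>\<kappa> > 0\<close>] by metis
    have "m * \<kappa> div \<kappa> \<le> (n - n0) div \<kappa>" using n by (intro div_le_mono) simp
    then have "m \<le> p" using lp(3) \<open>\<kappa> > 0\<close> by simp
    then have "m * norm D \<le> p * norm D" by (intro mult_right_mono) auto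
    also have "\<dots> = norm (real p *\<^sub>R D)" by simp
    also have "\<dots> \<le> norm (q (Suc n)) + dist (q (Suc n)) (real p *\<^sub>R D)"
      by (metis dist_commute dist_norm norm_triangle_sub)
    also have "\<dots> \<le> norm (q (Suc n)) + (E + 1)"
      using near[OF lp(1)] runs_forever_wall[OF run, of n] lp(2) by simp
    finally show ?thesis using m by (simp add: outside_disc_def)
  qed
  have "period q w > N"
  proof (rule ccontr)
    assume "\<not> N < period q w"
    moreover have "0 < period q w" using r by (simp add: repeats_def)
    ultimately obtain n where "n \<ge> n0 + m * \<kappa>" "\<not> same_type (w n) (w (n + period q w))"
      using aperiodic[of "period q w" "n0 + m * \<kappa>"] by auto
    then show False using r far by (auto simp: repeats_def)
  qed
  with tp show ?thesis by blast
qed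

section \<open>Aperiodicity of the sequence of wall types\<close>

definition row_types :: "bool list" where
  "row_types = [False, False, True, False, True, False]"

lemma row_types_no_pair: "j < 6 \<Longrightarrow> \<not> (row_types ! j \<and> row_types ! (Suc j mod 6))"
proof -
  assume "j < 6"
  then consider "j = 0" | "j = 1" | "j = 2" | "j = 3" | "j = 4" | "j = 5" by linarith
  then show ?thesis by cases (simp_all add: row_types_def)
qed

text \<open>A period \<open>k\<close> would spread the 6-periodicity of one stretch of length at
  least \<open>k + 6\<close> to all later indices. Then the pattern \<open>row_types\<close> would
  continue forever, but it has no two cyclically adjacent horizontal entries.\<close>

lemma long_rows_aperiodic:
  fixes t :: "nat \<Rightarrow> bool"
  assumes "0 < k" "k + 6 \<le> l"
    and rows: "\<And>n1. \<exists>n\<ge>n1. \<forall>j<l. t (n + j) = row_types ! (j mod 6)"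
    and pairs: "\<And>n1. \<exists>n\<ge>n1. t n \<and> t (Suc n)"
  shows "\<exists>n\<ge>n1. t n \<noteq> t (n + k)"
proof (rule ccontr)
  assume "\<not> ?thesis"
  then have per: "\<And>n. n \<ge> n1 \<Longrightarrow> t (n + k) = t n" by blast
  obtain n where n: "n \<ge> n1" "\<And>j. j < l \<Longrightarrow> t (n + j) = row_types ! (j mod 6)"
    using rows[of n1] by blast
  \<comment> \<open>For \<open>j < k\<close> both indices lie in the stretch; larger
    \<open>j\<close> are moved back by \<open>k\<close>.\<close>
  have six: "t (n + j + 6) = t (n + j)" for j
  proof (induction j rule: less_induct)
    case (less j)
    show ?case
    proof (cases "j < k")
      case True
      then have "j < l" "j + 6 < l" using assms(2) by auto
      then show ?thesis using n(2)[of j] n(2)[of "j + 6"] by (simp add: add.assoc)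
    next
      case False
      define i where "i = j - k"
      have i: "j = i + k" "i < j" using False assms(1) by (auto simp: i_def)
      have "t (n + j + 6) = t (n + i + 6 + k)" by (simp add: i algebra_simps)
      also have "\<dots> = t (n + i + 6)" using n(1) by (intro per) simp
      also have "\<dots> = t (n + i)" using less i by blast
      also have "\<dots> = t (n + i + k)" using n(1) by (intro per[symmetric]) simp
      finally show ?thesis by (simp add: i algebra_simps)
    qed
  qed
  have all: "t (n + j) = row_types ! (j mod 6)" for j
  proof (induction j rule: less_induct)
    case (less j)
    show ?case
    proof (cases "j < 6")
      case True
      then show ?thesis using n(2)[of j] assms(2) by simp
    next
      case False
      then have "t (n + j) = t (n + (j - 6))" using six[of "j - 6"] by simp
      also have "\<dots> = row_types ! (j mod 6)" using less[of "j - 6"] False by (simp add: mod_if[of j])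
      finally show ?thesis .
    qed
  qed
  obtain i where i: "i \<ge> n" "t i" "t (Suc i)" using pairs[of n] by blast
  then have "row_types ! ((i - n) mod 6)" "row_types ! (Suc (i - n) mod 6)"
    using all[of "i - n"] all[of "Suc (i - n)"] by (auto simp: Suc_diff_le)
  then show False using row_types_no_pair[of "(i - n) mod 6"] by (simp add: mod_Suc_eq)
qed

section \<open>The periodic tunnel\<close>

lemma orbit_add: "orbit T x (k + l) = orbit T (orbit T x k) l"
  by (simp add: add.commute[of k] funpow_add)

lemma symmetry_id: "symmetry id id"
proof -
  have "(1::real) \<noteq> 0 \<and> (1::real) \<noteq> 0 \<and> (\<forall>x y. same_type x y \<longrightarrow>
      displacement (id x) (id y) = (1 * fst (displacement x y), 1 * snd (displacement x y)))"
    by simp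
  then show ?thesis unfolding symmetry_def by (intro conjI) (blast | simp)+
qed

lemma symmetry_horizontal: "symmetry f g \<Longrightarrow> horizontal (f x) = horizontal x"
  unfolding symmetry_def by blast

lemma shift_comp: "shift a b \<circ> shift c d = shift (a + c) (b + d)"
proof
  fix x show "(shift a b \<circ> shift c d) x = shift (a + c) (b + d) x" by (cases x) auto
qed

lemma shift_state_comp: "shift_state a b \<circ> shift_state c d = shift_state (a + c) (b + d)"
  by auto

lemma shift_zero: "shift 0 0 = id"
proof
  fix x show "shift 0 0 x = id x" by (cases x) auto
qed

lemma shift_state_zero: "shift_state 0 0 = id"
  by auto

lemma horizontal_shift [simp]: "horizontal (shift a b x) = horizontal x"
  by (cases x) auto

lemma displacement_shift: "displacement (shift a b x) (shift c d x) = (of_int (c - a), of_int (d - b))"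
  by (cases x) (auto simp: displacement_simps)

text \<open>Joins the two halves: \<open>leads\<close> supplies the order of the events, and the
  simulation, carried over by the symmetry, supplies the walls.\<close>

lemma orbit_exec:
  assumes "symmetry f g" "agree f h ws hs" "leads T es a a'"
    "list_all (\<lambda>x. height x \<ge> h) (walls_met es (entry, ws))"
    "fold cross es (entry, ws) = (k entry, ws @ new)"
  shows "orbit T (a, T, g entry, hs) (length es) = (a', T, (g \<circ> k) entry, hs @ map f new)"
    "agree f h (ws @ new) (hs @ map f new)"
proof -
  have "orbit T (a, T, g entry, hs) (length es) = (a', T, fold cross es (g entry, hs))"
    using assms(3) unfolding leads_def by blast
  then show "orbit T (a, T, g entry, hs) (length es) = (a', T, (g \<circ> k) entry, hs @ map f new)"
    "agree f h (ws @ new) (hs @ map f new)"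
    using exec_symmetry[OF assms(1,2,4,5)] by (simp_all only: comp_apply)
qed

text \<open>Recentres the local frame at a new entry cell, raising the height below which nothing is
  compared.\<close>

lemma agree_comp:
  assumes "agree f h ws hs"
    and "\<And>x. height x \<ge> h' \<Longrightarrow> height (f' x) \<ge> h \<and> (f' x \<in> set ws \<longleftrightarrow> x \<in> set ws')"
  shows "agree (f \<circ> f') h' ws' hs"
  using assms unfolding agree_def by auto

lemma agree_row_below:
  assumes "agree f (- 1) row_below hs"
  shows "agree f 0 [Horizontal 0 0] hs"
proof -
  have "x \<in> set row_below \<longleftrightarrow> x = Horizontal 0 0" if "height x \<ge> 0" for x
    using that by (cases x) (auto simp: row_below_def)
  then show ?thesis using assms by (auto simp: agree_def)
qed

lemma length_row_word: "length row_word = 12"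
  by (simp add: row_word_def block_def)

lemma orbit_row:
  assumes "symmetry f g" "agree f 0 [Horizontal 0 0] hs"
    and "T = 3 + \<epsilon>" "0 < \<epsilon>" "3 * \<epsilon> < a" "a \<le> 1"
  shows "orbit T (a, T, g entry, hs) 12 =
      (a - 3 * \<epsilon>, T, (g \<circ> shift_state 1 1) entry, hs @ map f row_hits)"
    "agree (f \<circ> shift 1 1) (- 1) row_below (hs @ map f row_hits)"
proof -
  note ex = orbit_exec[where k = "shift_state 1 1", OF assms(1,2) leads_row[OF assms(3-6)] row_exec(2,1)]
  show "orbit T (a, T, g entry, hs) 12 =
      (a - 3 * \<epsilon>, T, (g \<circ> shift_state 1 1) entry, hs @ map f row_hits)"
    using ex(1) length_row_word by (simp only:)
  show "agree (f \<circ> shift 1 1) (- 1) row_below (hs @ map f row_hits)"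
  proof (rule agree_comp[OF ex(2)])
    fix x :: wall assume "height x \<ge> - 1"
    then show "height (shift 1 1 x) \<ge> 0 \<and>
        (shift 1 1 x \<in> set ([Horizontal 0 0] @ row_hits) \<longleftrightarrow> x \<in> set row_below)"
      by (cases x) (auto simp: row_hits_def row_below_def)
  qed
qed

lemma orbit_turn:
  assumes "symmetry f g" "agree f (- 1) row_below hs"
    and "T = 3 + \<epsilon>" "14 * \<epsilon> < 1" "i < 3" "i * \<epsilon> < a" "a < (i + 1) * \<epsilon>"
  shows "orbit T (a, T, g entry, hs) 57 =
      (a + 1 - 14 * \<epsilon>, T, (g \<circ> shift_state 3 2) entry, hs @ map f (turn_hits i))"
    "agree (f \<circ> shift 3 2) 0 [Horizontal 0 0] (hs @ map f (turn_hits i))"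
proof -
  note ex = orbit_exec[where k = "shift_state 3 2", OF assms(1,2) leads_turn[OF assms(3-7)] turn_exec(2,1)[OF assms(5)]]
  have "length (turn_word i) = 57"
    using assms(5) unfolding less_three by (auto simp: turn_word_def block_def long_block_def eval_nat_numeral)
  then show "orbit T (a, T, g entry, hs) 57 =
      (a + 1 - 14 * \<epsilon>, T, (g \<circ> shift_state 3 2) entry, hs @ map f (turn_hits i))"
    using ex(1) by simp
  show "agree (f \<circ> shift 3 2) 0 [Horizontal 0 0] (hs @ map f (turn_hits i))"
  proof (rule agree_comp[OF ex(2)])
    fix x :: wall assume "height x \<ge> 0"
    then show "height (shift 3 2 x) \<ge> - 1 \<and>
        (shift 3 2 x \<in> set (row_below @ turn_hits i) \<longleftrightarrow> x \<in> set [Horizontal 0 0])"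
      by (cases x) (auto simp: turn_hits_def row_below_def)
  qed
qed

definition rows_hits :: "nat \<Rightarrow> wall list" where
  "rows_hits j = concat (map (\<lambda>i. map (shift (int i) (int i)) row_hits) [0..<j])"

text \<open>The last conjunct needs \<open>0 < j\<close>, because \<open>row_below\<close> describes
  the traces of a regular row just passed, and the first entry may have a different past.\<close>

lemma orbit_rows:
  assumes sym: "symmetry f g" and ag: "agree f 0 [Horizontal 0 0] hs"
    and T: "T = 3 + \<epsilon>" and \<epsilon>: "0 < \<epsilon>" and a: "3 * real j * \<epsilon> < a" "a \<le> 1"
  shows "orbit T (a, T, g entry, hs) (12 * j) =
      (a - 3 * real j * \<epsilon>, T, (g \<circ> shift_state (int j) (int j)) entry, hs @ map f (rows_hits j)) \<and>
    agree (f \<circ> shift (int j) (int j)) 0 [Horizontal 0 0] (hs @ map f (rows_hits j)) \<and>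
    (0 < j \<longrightarrow> agree (f \<circ> shift (int j) (int j)) (- 1) row_below (hs @ map f (rows_hits j)))"
  using a
proof (induction j)
  case 0
  have "rows_hits 0 = []" by (simp add: rows_hits_def)
  then show ?case using ag by (simp add: shift_zero[unfolded id_def] shift_state_zero[unfolded id_def] comp_def)
next
  case (Suc j)
  define hs' where "hs' = hs @ map f (rows_hits j)"
  define f' where "f' = f \<circ> shift (int j) (int j)"
  define g' where "g' = g \<circ> shift_state (int j) (int j)"
  have jm: "3 * real j * \<epsilon> < a" using Suc.prems \<epsilon> by (simp add: algebra_simps)
  have IH: "orbit T (a, T, g entry, hs) (12 * j) = (a - 3 * real j * \<epsilon>, T, g' entry, hs')"
    "agree f' 0 [Horizontal 0 0] hs'"
    using Suc.IH[OF jm Suc.prems(2)] unfolding hs'_def f'_def g'_def by blast+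
  have sym': "symmetry f' g'" unfolding f'_def g'_def by (intro symmetry_comp sym symmetry_shift)
  have "0 \<le> 3 * real j * \<epsilon>" using \<epsilon> by simp
  then have a': "3 * \<epsilon> < a - 3 * real j * \<epsilon>" "a - 3 * real j * \<epsilon> \<le> 1"
    using Suc.prems by (auto simp: algebra_simps)
  note row = orbit_row[OF sym' IH(2) T \<epsilon> a']
  have hs: "hs' @ map f' row_hits = hs @ map f (rows_hits (Suc j))"
    by (simp add: hs'_def f'_def rows_hits_def)
  have comp: "g' \<circ> shift_state 1 1 = g \<circ> shift_state (int (Suc j)) (int (Suc j))"
    "f' \<circ> shift 1 1 = f \<circ> shift (int (Suc j)) (int (Suc j))"
    by (simp_all add: g'_def f'_def comp_assoc shift_state_comp shift_comp add.commute)
  have "12 * Suc j = 12 * j + 12" by simp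
  then have "orbit T (a, T, g entry, hs) (12 * Suc j) =
      (a - 3 * real j * \<epsilon> - 3 * \<epsilon>, T, (g' \<circ> shift_state 1 1) entry, hs' @ map f' row_hits)"
    by (simp only: orbit_add IH(1) row(1))
  moreover have "a - 3 * real j * \<epsilon> - 3 * \<epsilon> = a - 3 * real (Suc j) * \<epsilon>"
    by (simp add: algebra_simps)
  ultimately have "orbit T (a, T, g entry, hs) (12 * Suc j) =
      (a - 3 * real (Suc j) * \<epsilon>, T, (g' \<circ> shift_state 1 1) entry, hs' @ map f' row_hits)"
    by (simp only:)
  then show ?case
    using row(2) agree_row_below[OF row(2)] unfolding hs comp by blast
qed

definition cycle_hits :: "nat \<Rightarrow> nat \<Rightarrow> wall list" where
  "cycle_hits i l = turn_hits i @ map (shift 3 2) (rows_hits (Suc l))"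

text \<open>The turn raises \<open>a\<close> by \<open>1 - 14 * \<epsilon>\<close>, and
  \<open>Suc l\<close> rows lower it by \<open>3 * \<epsilon>\<close> each; these cancel as
  \<open>(3 * l + 17) * \<epsilon> = 1\<close>. The shifts add up to
  \<open>(3, 2) + (l + 1) * (1, 1)\<close>.\<close>

lemma orbit_cycle:
  assumes sym: "symmetry f g" and ag: "agree f (- 1) row_below hs"
    and \<epsilon>: "\<epsilon> = 1 / (3 * real l + 17)" and T: "T = 3 + \<epsilon>"
    and i: "i < 3" "i * \<epsilon> < a" "a < (i + 1) * \<epsilon>"
  shows "orbit T (a, T, g entry, hs) (57 + 12 * Suc l) =
      (a, T, (g \<circ> shift_state (int l + 4) (int l + 3)) entry, hs @ map f (cycle_hits i l))"
    "agree (f \<circ> shift (int l + 4) (int l + 3)) (- 1) row_below (hs @ map f (cycle_hits i l))"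
proof -
  have pos: "0 < \<epsilon>" and one: "(3 * real l + 17) * \<epsilon> = 1" by (simp_all add: \<epsilon>)
  have le: "real l * \<epsilon> \<ge> 0" using pos by simp
  have sum: "3 * (real l * \<epsilon>) + 17 * \<epsilon> = 1" using one by (simp add: algebra_simps)
  then have "14 * \<epsilon> < 1" using pos le by linarith
  note turn = orbit_turn[OF sym ag T this i]
  define hs' where "hs' = hs @ map f (turn_hits i)"
  define f' where "f' = f \<circ> shift 3 2"
  define g' where "g' = g \<circ> shift_state 3 2"
  define b where "b = a + 1 - 14 * \<epsilon>"
  have sym': "symmetry f' g'" unfolding f'_def g'_def by (intro symmetry_comp sym symmetry_shift)
  have "real i * \<epsilon> \<ge> 0" using pos by simp
  then have "0 < a" using i(2) by linarith
  have "real (i + 1) * \<epsilon> \<le> 3 * \<epsilon>" using i(1) pos by (intro mult_right_mono) auto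
  then have "a < 3 * \<epsilon>" using i(3) by linarith
  have b: "3 * real (Suc l) * \<epsilon> < b" "b \<le> 1" "b - 3 * real (Suc l) * \<epsilon> = a"
  proof -
    have "3 * real (Suc l) * \<epsilon> = 3 * (real l * \<epsilon>) + 3 * \<epsilon>" by (simp add: algebra_simps)
    then show "3 * real (Suc l) * \<epsilon> < b" "b \<le> 1" "b - 3 * real (Suc l) * \<epsilon> = a"
      using sum \<open>0 < a\<close> \<open>a < 3 * \<epsilon>\<close> pos unfolding b_def by linarith+
  qed
  have t: "orbit T (a, T, g entry, hs) 57 = (b, T, g' entry, hs')"
    "agree f' 0 [Horizontal 0 0] hs'"
    using turn by (simp_all add: hs'_def f'_def g'_def b_def)
  have r: "orbit T (b, T, g' entry, hs') (12 * Suc l) =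
      (a, T, (g' \<circ> shift_state (int (Suc l)) (int (Suc l))) entry, hs' @ map f' (rows_hits (Suc l)))"
    "agree (f' \<circ> shift (int (Suc l)) (int (Suc l))) (- 1) row_below (hs' @ map f' (rows_hits (Suc l)))"
    using orbit_rows[OF sym' t(2) T pos b(1,2)] b(3) by auto
  have hs: "hs' @ map f' (rows_hits (Suc l)) = hs @ map f (cycle_hits i l)"
    by (simp add: hs'_def f'_def cycle_hits_def)
  have comp: "g' \<circ> shift_state (int (Suc l)) (int (Suc l)) = g \<circ> shift_state (int l + 4) (int l + 3)"
    "f' \<circ> shift (int (Suc l)) (int (Suc l)) = f \<circ> shift (int l + 4) (int l + 3)"
    by (simp_all add: g'_def f'_def comp_assoc shift_state_comp shift_comp add.commute)
  show "orbit T (a, T, g entry, hs) (57 + 12 * Suc l) =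
      (a, T, (g \<circ> shift_state (int l + 4) (int l + 3)) entry, hs @ map f (cycle_hits i l))"
    using r(1) by (simp only: orbit_add t(1) hs comp)
  show "agree (f \<circ> shift (int l + 4) (int l + 3)) (- 1) row_below (hs @ map f (cycle_hits i l))"
    using r(2) by (simp only: hs comp)
qed

definition cycles_hits :: "(wall \<Rightarrow> wall) \<Rightarrow> nat \<Rightarrow> nat \<Rightarrow> nat \<Rightarrow> wall list" where
  "cycles_hits f i l p =
     concat (map (\<lambda>r. map (f \<circ> shift (int r * (int l + 4)) (int r * (int l + 3))) (cycle_hits i l))
       [0..<p])"

lemma orbit_cycles:
  assumes sym: "symmetry f g" and ag: "agree f (- 1) row_below hs"
    and \<epsilon>: "\<epsilon> = 1 / (3 * real l + 17)" and T: "T = 3 + \<epsilon>"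
    and i: "i < 3" "i * \<epsilon> < a" "a < (i + 1) * \<epsilon>"
  shows "orbit T (a, T, g entry, hs) (p * (57 + 12 * Suc l)) =
      (a, T, (g \<circ> shift_state (int p * (int l + 4)) (int p * (int l + 3))) entry,
       hs @ cycles_hits f i l p) \<and>
    agree (f \<circ> shift (int p * (int l + 4)) (int p * (int l + 3))) (- 1) row_below
      (hs @ cycles_hits f i l p)"
proof (induction p)
  case 0
  have "cycles_hits f i l 0 = []" by (simp add: cycles_hits_def)
  then show ?case using ag by (simp add: shift_zero[unfolded id_def] shift_state_zero[unfolded id_def] comp_def)
next
  case (Suc p)
  define f' where "f' = f \<circ> shift (int p * (int l + 4)) (int p * (int l + 3))"
  define g' where "g' = g \<circ> shift_state (int p * (int l + 4)) (int p * (int l + 3))"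
  define hs' where "hs' = hs @ cycles_hits f i l p"
  have IH: "orbit T (a, T, g entry, hs) (p * (57 + 12 * Suc l)) = (a, T, g' entry, hs')"
    "agree f' (- 1) row_below hs'"
    using Suc.IH unfolding f'_def g'_def hs'_def by blast+
  have sym': "symmetry f' g'" unfolding f'_def g'_def by (intro symmetry_comp sym symmetry_shift)
  note cyc = orbit_cycle[OF sym' IH(2) \<epsilon> T i]
  have comp: "g' \<circ> shift_state (int l + 4) (int l + 3) =
      g \<circ> shift_state (int (Suc p) * (int l + 4)) (int (Suc p) * (int l + 3))"
    "f' \<circ> shift (int l + 4) (int l + 3) =
      f \<circ> shift (int (Suc p) * (int l + 4)) (int (Suc p) * (int l + 3))"
    by (simp_all add: g'_def f'_def comp_assoc shift_state_comp shift_comp algebra_simps)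
  have "Suc p * (57 + 12 * Suc l) = p * (57 + 12 * Suc l) + (57 + 12 * Suc l)" by simp
  then have "orbit T (a, T, g entry, hs) (Suc p * (57 + 12 * Suc l)) =
      (a, T, (g' \<circ> shift_state (int l + 4) (int l + 3)) entry, hs' @ map f' (cycle_hits i l))"
    by (simp only: orbit_add[where k = "p * (57 + 12 * Suc l)"] IH(1) cyc(1))
  moreover have "hs' @ map f' (cycle_hits i l) = hs @ cycles_hits f i l (Suc p)"
    by (simp add: hs'_def f'_def cycles_hits_def)
  ultimately show ?case
    using cyc(2) unfolding comp by (simp only: conj_absorb simp_thms)
qed

section \<open>Types of the walls in a cycle, and the period\<close>

lemma nth_concat_uniform:
  assumes "\<And>i. i < p \<Longrightarrow> length (F i) = \<kappa>" "r < \<kappa>" "k < p"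
  shows "concat (map F [0..<p]) ! (k * \<kappa> + r) = F k ! r"
proof -
  have len: "q \<le> p \<Longrightarrow> length (concat (map F [0..<q])) = q * \<kappa>" for q
    by (induction q) (use assms(1) in auto)
  have "[0..<p] = [0..<k] @ k # [Suc k..<p]"
    using assms(3) upt_add_eq_append[of 0 k "p - k"] by (simp add: upt_conv_Cons)
  then show ?thesis
    using len[of k] assms by (simp add: nth_append)
qed

lemma length_row_hits: "length row_hits = 6"
  by (simp add: row_hits_def)

lemma length_rows_hits: "length (rows_hits j) = 6 * j"
  by (induction j) (auto simp: rows_hits_def length_row_hits)

lemma length_turn_hits: "length (turn_hits i) = 20"
  by (simp add: turn_hits_def)

lemma length_cycle_hits: "length (cycle_hits i l) = 20 + 6 * Suc l"
  by (simp add: cycle_hits_def length_turn_hits length_rows_hits)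

lemma rows_hits_types:
  assumes "j < 6 * k"
  shows "horizontal (rows_hits k ! j) = row_types ! (j mod 6)"
proof -
  have "j div 6 < k" using assms by (simp add: less_mult_imp_div_less mult.commute)
  then have "concat (map (\<lambda>i. map (shift (int i) (int i)) row_hits) [0..<k]) ! (j div 6 * 6 + j mod 6) =
      map (shift (int (j div 6)) (int (j div 6))) row_hits ! (j mod 6)"
    by (intro nth_concat_uniform) (auto simp: length_row_hits)
  then have "rows_hits k ! j = shift (int (j div 6)) (int (j div 6)) (row_hits ! (j mod 6))"
    by (simp add: rows_hits_def length_row_hits)
  moreover have "horizontal (row_hits ! n) = row_types ! n" if "n < 6" for n
  proof -
    have "map horizontal row_hits = row_types" by (simp add: row_hits_def row_types_def)
    then show ?thesis using that nth_map[of n row_hits horizontal] by (simp add: length_row_hits)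
  qed
  ultimately show ?thesis by simp
qed

text \<open>Entries 16 and 17 are \<open>Horizontal 0 1\<close> and \<open>Horizontal 3 0\<close>,
  the pair that breaks the pattern of the regular rows.\<close>

lemma cycle_hits_types:
  "j < 6 * Suc l \<Longrightarrow> horizontal (cycle_hits i l ! (20 + j)) = row_types ! (j mod 6)"
  "horizontal (cycle_hits i l ! 16)" "horizontal (cycle_hits i l ! 17)"
proof -
  show "j < 6 * Suc l \<Longrightarrow> horizontal (cycle_hits i l ! (20 + j)) = row_types ! (j mod 6)"
    using rows_hits_types[of j "Suc l"] length_rows_hits[of "Suc l"]
    by (simp add: cycle_hits_def nth_append length_turn_hits)
  show "horizontal (cycle_hits i l ! 16)" "horizontal (cycle_hits i l ! 17)"
    by (auto simp: cycle_hits_def nth_append length_turn_hits) (auto simp: turn_hits_def eval_nat_numeral)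
qed

lemma cycles_tunnel:
  fixes i :: nat and \<epsilon> a T :: real
  assumes sym: "symmetry f g" and ag: "agree f (- 1) row_below hs"
    and \<epsilon>: "\<epsilon> = 1 / (3 * real l + 17)" and T: "T = 3 + \<epsilon>"
    and i: "i < 3" "i * \<epsilon> < a" "a < (i + 1) * \<epsilon>"
    and x: "in_range T x" "hits x = []" "orbit T x k = (a, T, g entry, hs)"
    and s: "0 < c" "initial_direction s = c *\<^sub>R velocity (1 / T) (state_of x)"
    and N: "N \<le> 6 * l"
  shows "\<exists>q w. tunnels_periodically (position (1 / T) x) s q w \<and> period q w > N"
proof -
  \<comment> \<open>Collisions per cycle: 20 in the turn and 6 in each regular row. The number of
    steps, \<open>57 + 12 * Suc l\<close>, is larger because many crossed walls are already
    erased.\<close>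
  define \<kappa> where "\<kappa> = 20 + 6 * Suc l"
  define n0 where "n0 = length hs"
  define F where "F r = map (f \<circ> shift (int r * (int l + 4)) (int r * (int l + 3))) (cycle_hits i l)" for r
  have lenF: "length (F r) = \<kappa>" for r by (simp add: F_def length_cycle_hits \<kappa>_def)
  have orb: "hits (orbit T x (k + p * (57 + 12 * Suc l))) = hs @ concat (map F [0..<p])" for p
    using orbit_cycles[OF sym ag \<epsilon> T i, of p] unfolding orbit_add x(3) F_def cycles_hits_def
    by (simp add: hits_def)
  have len: "length (concat (map F [0..<p])) = p * \<kappa>" for p
    by (induction p) (auto simp: lenF)
  have "0 < T" using T \<epsilon> by (simp add: add_pos_pos)
  have "\<exists>k. n < length (hits (orbit T x k))" for n
  proof
    have "n < Suc n * 1" by simp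
    also have "\<dots> \<le> Suc n * \<kappa>" by (intro mult_le_mono) (auto simp: \<kappa>_def)
    finally show "n < length (hits (orbit T x (k + Suc n * (57 + 12 * Suc l))))"
      unfolding orb length_append len by (rule trans_less_add2)
  qed
  from orbit_runs_forever[OF \<open>0 < T\<close> x(1,2) this s]
  obtain q w where run: "runs_forever (position (1 / T) x) s q w"
    and w: "\<And>n k. n < length (hits (orbit T x k)) \<Longrightarrow> w n = hits (orbit T x k) ! n"
    by blast
  have wF: "w (n0 + r + p * \<kappa>) = F p ! r" if "r < \<kappa>" for r p
  proof -
    have lt: "r + p * \<kappa> < Suc p * \<kappa>" using that by simp
    then have "w (n0 + r + p * \<kappa>) = (hs @ concat (map F [0..<Suc p])) ! (n0 + r + p * \<kappa>)"
      unfolding orb[symmetric] by (intro w) (simp only: orb length_append len, simp add: n0_def)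
    also have "\<dots> = concat (map F [0..<Suc p]) ! (p * \<kappa> + r)"
      by (simp add: nth_append n0_def add.commute)
    also have "\<dots> = F p ! r" using that lenF by (intro nth_concat_uniform) auto
    finally show ?thesis .
  qed
  have wf: "w (n0 + r + p * \<kappa>) =
      f (shift (int p * (int l + 4)) (int p * (int l + 3)) (cycle_hits i l ! r))" if "r < \<kappa>" for r p
    using wF[OF that] that by (simp add: F_def length_cycle_hits \<kappa>_def)
  define t where "t n = horizontal (w n)" for n
  have t: "t (n0 + r + p * \<kappa>) = horizontal (cycle_hits i l ! r)" if "r < \<kappa>" for r p
    using wf[OF that] sym by (simp add: t_def symmetry_horizontal)
  obtain \<alpha> \<beta> where nz: "\<alpha> \<noteq> 0" "\<beta> \<noteq> 0" and disp: "\<And>x y. same_type x y \<Longrightarrow>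
      displacement (f x) (f y) = (\<alpha> * fst (displacement x y), \<beta> * snd (displacement x y))"
    using sym unfolding symmetry_def by blast
  have "\<kappa> > 0" by (simp add: \<kappa>_def)
  \<comment> \<open>Collisions \<open>n\<close> and \<open>n + \<kappa>\<close> are the same entry
    of successive cycles, hence translates in the local frame.\<close>
  have shape: "same_type (w n) (w (n + \<kappa>)) \<and>
      displacement (w n) (w (n + \<kappa>)) = (\<alpha> * (real l + 4), \<beta> * (real l + 3))" if n: "n \<ge> n0" for n
  proof -
    obtain r p where rp: "r < \<kappa>" "n = n0 + r + p * \<kappa>"
      using index_split[OF \<open>\<kappa> > 0\<close> n] by metis
    have "n + \<kappa> = n0 + r + Suc p * \<kappa>" using rp by simp
    then show ?thesis
      using wf[OF rp(1), of p] wf[OF rp(1), of "Suc p"] rp(2) sym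
      by (simp add: same_type_iff symmetry_horizontal disp displacement_shift algebra_simps)
  qed
  have "\<exists>n\<ge>n1. \<not> same_type (w n) (w (n + k))" if "0 < k" "k \<le> N" for k n1
  proof -
    have "\<exists>n\<ge>n1. t n \<noteq> t (n + k)"
    proof (rule long_rows_aperiodic[OF \<open>0 < k\<close>, where l = "6 * Suc l"])
      show "k + 6 \<le> 6 * Suc l" using that N by simp
    next
      fix n1
      have "t (n0 + 20 + n1 * \<kappa> + j) = row_types ! (j mod 6)" if "j < 6 * Suc l" for j
      proof -
        have "n0 + 20 + n1 * \<kappa> + j = n0 + (20 + j) + n1 * \<kappa>" by simp
        moreover have "20 + j < \<kappa>" using that by (simp add: \<kappa>_def)
        ultimately show ?thesis using t[of "20 + j" n1] cycle_hits_types(1)[OF that] by (simp only:)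
      qed
      moreover have "n1 \<le> n1 * \<kappa>" using \<open>\<kappa> > 0\<close> by simp
      then have "n1 \<le> n0 + 20 + n1 * \<kappa>" by (rule trans_le_add2)
      ultimately show "\<exists>n\<ge>n1. \<forall>j<6 * Suc l. t (n + j) = row_types ! (j mod 6)" by blast
    next
      fix n1
      have "t (n0 + 16 + n1 * \<kappa>)" "t (n0 + 17 + n1 * \<kappa>)"
        using t[of 16 n1] t[of 17 n1] cycle_hits_types(2,3) by (auto simp: \<kappa>_def)
      moreover have "n0 + 17 + n1 * \<kappa> = Suc (n0 + 16 + n1 * \<kappa>)" by simp
      moreover have "n1 \<le> n1 * \<kappa>" using \<open>\<kappa> > 0\<close> by simp
      then have "n1 \<le> n0 + 16 + n1 * \<kappa>" by (rule trans_le_add2)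
      ultimately show "\<exists>n\<ge>n1. t n \<and> t (Suc n)" by metis
    qed
    then show ?thesis by (simp add: t_def same_type_iff)
  qed
  moreover have "(\<alpha> * (real l + 4), \<beta> * (real l + 3)) \<noteq> 0"
    using nz by (auto simp: zero_prod_def)
  ultimately have "tunnels_periodically (position (1 / T) x) s q w \<and> period q w > N"
    using shape by (intro drift_tunnels[OF run \<open>\<kappa> > 0\<close>]) blast+
  then show ?thesis by blast
qed

section \<open>The start\<close>

text \<open>Regular rows are traversed until the residue is below \<open>3 * \<epsilon>\<close>;
  then the periodic cycles begin.\<close>

lemma row_entry_tunnels:
  fixes \<epsilon> a T :: real
  assumes sym: "symmetry f g" and ag: "agree f 0 [Horizontal 0 0] hs"
    and \<epsilon>: "\<epsilon> = 1 / (3 * real l + 17)" and T: "T = 3 + \<epsilon>"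
    and a: "3 * \<epsilon> < a" "a \<le> 1"
    and x: "in_range T x" "hits x = []" "orbit T x k = (a, T, g entry, hs)"
    and s: "0 < c" "initial_direction s = c *\<^sub>R velocity (1 / T) (state_of x)"
    and N: "N \<le> 6 * l"
  shows "\<exists>q w. tunnels_periodically (position (1 / T) x) s q w \<and> period q w > N"
proof -
  have pos: "0 < \<epsilon>" by (simp add: \<epsilon>)
  define m where "m = nat \<lfloor>a / \<epsilon>\<rfloor>"
  have "3 \<le> a / \<epsilon>" using a pos by (simp add: field_simps)
  then have "3 \<le> \<lfloor>a / \<epsilon>\<rfloor>" by (simp add: le_floor_iff)
  then have m: "int m = \<lfloor>a / \<epsilon>\<rfloor>" "3 \<le> m" unfolding m_def by linarith+
  then have "real m \<le> a / \<epsilon>" "a / \<epsilon> < real m + 1"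
    by (metis of_int_floor_le of_int_of_nat_eq, metis floor_correct of_int_add of_int_of_nat_eq of_int_1)
  then have le: "m * \<epsilon> \<le> a" and less: "a < (m + 1) * \<epsilon>"
    using pos by (simp_all add: field_simps)
  have "in_range T (orbit T x k)" using x(1) by (rule in_range_orbit)
  then have "a - T \<noteq> of_int u + of_int v * T" for u v by (simp add: x(3) in_range_def)
  \<comment> \<open>As \<open>\<epsilon> = T - 3\<close>, equality would give
    \<open>a - T = - 3 * m + (m - 1) * T\<close>, which \<open>in_range\<close> forbids.\<close>
  from this[of "- 3 * int m" "int m - 1"] have "m * \<epsilon> \<noteq> a" by (auto simp: T algebra_simps)
  with le have le: "m * \<epsilon> < a" by simp
  define j where "j = m div 3"
  define i where "i = m mod 3"
  have "m = i + 3 * j" by (simp add: i_def j_def)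
  then have mij: "real m = real i + 3 * real j" by simp
  \<comment> \<open>From \<open>3 \<le> m\<close> at least one regular row precedes the turn, so
    \<open>row_below\<close> describes the erased walls.\<close>
  have "0 < j" "i < 3" using m by (auto simp: i_def j_def div_greater_zero_iff)
  have "0 \<le> i * \<epsilon>" using pos by simp
  define a' where "a' = a - 3 * real j * \<epsilon>"
  have a': "i * \<epsilon> < a'" "a' < (i + 1) * \<epsilon>"
    using le less mij by (auto simp: a'_def algebra_simps)
  then have "3 * real j * \<epsilon> < a" using \<open>0 \<le> i * \<epsilon>\<close> by (simp add: a'_def)
  note rows = orbit_rows[OF sym ag T pos this a(2)]
  have 1: "orbit T x (k + 12 * j) =
      (a', T, (g \<circ> shift_state (int j) (int j)) entry, hs @ map f (rows_hits j))"
    using rows by (simp only: orbit_add x(3) a'_def)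
  have 2: "agree (f \<circ> shift (int j) (int j)) (- 1) row_below (hs @ map f (rows_hits j))"
    using rows \<open>0 < j\<close> by blast
  have 3: "symmetry (f \<circ> shift (int j) (int j)) (g \<circ> shift_state (int j) (int j))"
    by (intro symmetry_comp sym symmetry_shift)
  show ?thesis
    by (rule cycles_tunnel[OF 3 2 \<epsilon> T \<open>i < 3\<close> a' x(1,2) 1 s N])
qed

text \<open>Here \<open>m\<close> counts the vertical lines met before the first horizontal
  one.\<close>

definition start_word :: "nat \<Rightarrow> nat \<Rightarrow> bool list" where
  "start_word m k = replicate m True @ [False] @ concat (replicate k block)"

text \<open>Four finite simulations from an intact grid. The symmetry \<open>F\<close> locates the
  untouched row entered at the end: downwards for \<open>m = 0\<close>, moving left for
  \<open>m = 1\<close>, and a mere translate of the standard entry otherwise.\<close>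

lemma start_exec:
  assumes "m < 4"
  obtains F G k hs where "symmetry F G" "k \<le> 7"
    "fold cross (start_word m k) (entry, []) = (G entry, [] @ hs)"
    "list_all (\<lambda>x. height x \<ge> - 9) (walls_met (start_word m k) (entry, []))"
    "\<And>x. height x \<ge> 0 \<Longrightarrow> (F x \<in> set hs \<longleftrightarrow> x \<in> set [Horizontal 0 0])"
proof -
  consider "m = 0" | "m = 1" | "m = 2" | "m = 3" using assms by linarith
  then show thesis
  proof cases
    case 1
    show thesis
    proof (rule that[of "shift 1 (- 1) \<circ> flip_y" "shift_state 1 (- 1) \<circ> flip_y_state" 3
          "[Horizontal 0 1, Vertical 1 0, Vertical 0 0, Horizontal 1 0, Vertical 2 0, Horizontal (- 1) 1, Vertical (- 1) 0]"])
      show "symmetry (shift 1 (- 1) \<circ> flip_y) (shift_state 1 (- 1) \<circ> flip_y_state)"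
        by (intro symmetry_comp symmetry_shift symmetry_flip_x symmetry_flip_y)
    next
      fix x :: wall assume "height x \<ge> 0"
      then show "((shift 1 (- 1) \<circ> flip_y) x \<in> set [Horizontal 0 1, Vertical 1 0, Vertical 0 0, Horizontal 1 0, Vertical 2 0, Horizontal (- 1) 1, Vertical (- 1) 0]
            \<longleftrightarrow> x \<in> set [Horizontal 0 0])"
        by (cases x) auto
    qed (unfold 1, unfold start_word_def block_def entry_def, code_simp+)
  next
    case 2
    show thesis
    proof (rule that[of "shift (- 1) 2 \<circ> flip_x" "shift_state (- 1) 2 \<circ> flip_x_state" 7
          "[Vertical 1 0, Horizontal 0 1, Vertical 0 0, Vertical 2 0, Horizontal 1 0, Vertical (- 1) 0, Horizontal (- 1) 1, Horizontal 2 0, Vertical 3 0, Vertical 0 1, Vertical 1 1, Horizontal (- 1) 2, Vertical (- 1) 1, Horizontal 1 1, Vertical 2 1]"])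
      show "symmetry (shift (- 1) 2 \<circ> flip_x) (shift_state (- 1) 2 \<circ> flip_x_state)"
        by (intro symmetry_comp symmetry_shift symmetry_flip_x symmetry_flip_y)
    next
      fix x :: wall assume "height x \<ge> 0"
      then show "((shift (- 1) 2 \<circ> flip_x) x \<in> set [Vertical 1 0, Horizontal 0 1, Vertical 0 0, Vertical 2 0, Horizontal 1 0, Vertical (- 1) 0, Horizontal (- 1) 1, Horizontal 2 0, Vertical 3 0, Vertical 0 1, Vertical 1 1, Horizontal (- 1) 2, Vertical (- 1) 1, Horizontal 1 1, Vertical 2 1]
            \<longleftrightarrow> x \<in> set [Horizontal 0 0])"
        by (cases x) auto
    qed (unfold 2, unfold start_word_def block_def entry_def, code_simp+)
  next
    case 3
    show thesis
    proof (rule that[of "shift 0 1" "shift_state 0 1" 2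
          "[Vertical 1 0, Vertical 0 0, Horizontal 0 1, Vertical 2 0, Horizontal 0 0, Vertical (- 1) 0]"])
      show "symmetry (shift 0 1) (shift_state 0 1)"
        by (intro symmetry_comp symmetry_shift symmetry_flip_x symmetry_flip_y)
    next
      fix x :: wall assume "height x \<ge> 0"
      then show "((shift 0 1) x \<in> set [Vertical 1 0, Vertical 0 0, Horizontal 0 1, Vertical 2 0, Horizontal 0 0, Vertical (- 1) 0]
            \<longleftrightarrow> x \<in> set [Horizontal 0 0])"
        by (cases x) auto
    qed (unfold 3, unfold start_word_def block_def entry_def, code_simp+)
  next
    case 4
    show thesis
    proof (rule that[of "shift 1 1" "shift_state 1 1" 2
          "[Vertical 1 0, Vertical 0 0, Horizontal 1 1, Vertical 2 0, Horizontal (- 1) 0, Vertical (- 1) 0]"])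
      show "symmetry (shift 1 1) (shift_state 1 1)"
        by (intro symmetry_comp symmetry_shift symmetry_flip_x symmetry_flip_y)
    next
      fix x :: wall assume "height x \<ge> 0"
      then show "((shift 1 1) x \<in> set [Vertical 1 0, Vertical 0 0, Horizontal 1 1, Vertical 2 0, Horizontal (- 1) 0, Vertical (- 1) 0]
            \<longleftrightarrow> x \<in> set [Horizontal 0 0])"
        by (cases x) auto
    qed (unfold 4, unfold start_word_def block_def entry_def, code_simp+)
  qed
qed

text \<open>For \<epsilon> tending to 0 the residue at the first horizontal line tends to
  \<open>a + m - 3 * \<beta>\<close>, and a unique integer \<open>m\<close> puts this limit into the
  interval from 0 (excluded) to 1 (included). At the limit 1 the term
  \<open>\<beta> * \<epsilon>\<close> keeps the residue strictly below 1.\<close>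

lemma start_phase:
  fixes a \<beta> :: real
  assumes "0 < a" "a < 1" "0 < \<beta>" "\<beta> < 1"
  obtains m :: nat and \<delta> where "m < 4" "0 < \<delta>"
    "\<And>\<epsilon>. 0 < \<epsilon> \<Longrightarrow> \<epsilon> < \<delta> \<Longrightarrow> 11 * \<epsilon> < a + m - \<beta> * (3 + \<epsilon>) \<and> a + m - \<beta> * (3 + \<epsilon>) < 1"
proof -
  define c where "c = \<lfloor>3 * \<beta> - a\<rfloor>"
  define m where "m = nat (c + 1)"
  have "- 1 \<le> c" "c < 3" using assms by (auto simp: c_def le_floor_iff floor_less_iff)
  then have m: "m < 4" "real m = of_int c + 1" by (auto simp: m_def)
  define d where "d = a + m - 3 * \<beta>"
  have "of_int c \<le> 3 * \<beta> - a" "3 * \<beta> - a < of_int c + 1" by (auto simp: c_def)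
  then have d: "0 < d" "d \<le> 1" using m(2) by (auto simp: d_def)
  show thesis
  \<comment> \<open>The factor 12 covers the margin \<open>11 * \<epsilon>\<close> together with
    \<open>\<beta> * \<epsilon> < \<epsilon>\<close>.\<close>
  proof (rule that[of m "d / 12"])
    fix \<epsilon> :: real assume \<epsilon>: "0 < \<epsilon>" "\<epsilon> < d / 12"
    have "\<beta> * \<epsilon> < \<epsilon>" "0 < \<beta> * \<epsilon>" using assms \<epsilon> by auto
    moreover have "a + m - \<beta> * (3 + \<epsilon>) = d - \<beta> * \<epsilon>" by (simp add: d_def algebra_simps)
    ultimately show "11 * \<epsilon> < a + m - \<beta> * (3 + \<epsilon>) \<and> a + m - \<beta> * (3 + \<epsilon>) < 1"
      using d \<epsilon> by linarith
  qed (use m d in auto)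
qed

lemma orbit_first_row:
  fixes m :: nat and a b :: real
  assumes "m < 4" "0 < a + m - b" "a + m - b < 1"
  shows "orbit T (a, b, c) (m + 1) = (a + m - b, T, fold cross (replicate m True @ [False]) c)"
proof -
  consider "m = 0" | "m = 1" | "m = 2" | "m = 3" using assms(1) by linarith
  then show ?thesis
    using assms(2,3) by cases (simp_all add: step_def eval_nat_numeral algebra_simps)
qed

lemma start_tunnels:
  fixes a \<beta> \<epsilon> T :: real and m :: nat
  assumes m: "m < 4" "11 * \<epsilon> < a + m - \<beta> * T" "a + m - \<beta> * T < 1"
    and \<epsilon>: "\<epsilon> = 1 / (3 * real l + 17)" and T: "T = 3 + \<epsilon>"
    and sym: "symmetry f g"
    and x: "in_range T (a, \<beta> * T, g entry, [])"
    and s: "0 < c" "initial_direction s = c *\<^sub>R velocity (1 / T) (g entry)"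
    and N: "N \<le> 6 * l"
  shows "\<exists>q w. tunnels_periodically (position (1 / T) (a, \<beta> * T, g entry, [])) s q w \<and> period q w > N"
proof -
  have pos: "0 < \<epsilon>" by (simp add: \<epsilon>)
  obtain F G k hs where st: "symmetry F G" "k \<le> 7"
    "fold cross (start_word m k) (entry, []) = (G entry, [] @ hs)"
    "list_all (\<lambda>x. height x \<ge> - 9) (walls_met (start_word m k) (entry, []))"
    "\<And>x. height x \<ge> 0 \<Longrightarrow> (F x \<in> set hs \<longleftrightarrow> x \<in> set [Horizontal 0 0])"
    using start_exec[OF m(1)] by metis
  define a1 where "a1 = a + m - \<beta> * T"
  have "agree f (- 9) [] []" by (simp add: agree_def)
  note ex = exec_symmetry[OF sym this st(4,3)]
  have a1: "11 * \<epsilon> < a1" "a1 < 1" using m by (auto simp: a1_def)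
  have "real k * \<epsilon> \<le> 7 * \<epsilon>" using st(2) pos by (intro mult_right_mono) auto
  \<comment> \<open>The margin 11 pays for at most 7 blocks and still leaves more than the
    \<open>3 * \<epsilon>\<close> that a regular row requires.\<close>
  then have k: "k * \<epsilon> < a1" "3 * \<epsilon> < a1 - k * \<epsilon>" "a1 - k * \<epsilon> \<le> 1"
    using a1 pos mult_nonneg_nonneg[of "real k" \<epsilon>] by linarith+
  let ?c = "fold cross (replicate m True @ [False]) (g entry, [])"
  have "orbit T (a, \<beta> * T, g entry, []) (m + 1) = (a1, T, ?c)"
    unfolding a1_def using m pos by (intro orbit_first_row) auto
  moreover have "leads T (concat (replicate k block)) a1 (a1 - k * \<epsilon>)"
    using leads_blocks[OF T pos k(1)] a1 by simp
  ultimately have "orbit T (a, \<beta> * T, g entry, []) (m + 1 + length (concat (replicate k block))) =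
      (a1 - k * \<epsilon>, T, fold cross (concat (replicate k block)) ?c)"
    unfolding orbit_add leads_def by metis
  also have "fold cross (concat (replicate k block)) ?c = (g (G entry), [] @ map f hs)"
    using ex by (simp add: start_word_def)
  finally have orb: "orbit T (a, \<beta> * T, g entry, []) (m + 1 + length (concat (replicate k block))) =
      (a1 - k * \<epsilon>, T, (g \<circ> G) entry, [] @ map f hs)" by simp
  have "agree (f \<circ> F) 0 [Horizontal 0 0] ([] @ map f hs)"
    using st(5) sym by (auto simp: agree_def symmetry_def inj_image_mem_iff)
  from row_entry_tunnels[OF symmetry_comp[OF sym st(1)] this \<epsilon> T k(2,3) x _ orb s(1) _ N]
  show ?thesis using s(2) by (simp add: hits_def state_of_def)
qed

section \<open>Choice of a slope that avoids all corners\<close>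

text \<open>If all four numbers were integers, sums over the two \<beta> would eliminate
  \<open>y\<close> and force \<open>x = 1 / 2\<close>, differences would eliminate \<open>x\<close>
  and force \<open>y = 1 / 2\<close>; but at the centre the numbers are half of odd
  integers.\<close>

lemma avoid_corners:
  fixes x y :: real
  assumes "0 < x" "x < 1" "0 < y" "y < 1"
  shows "\<exists>l\<in>{k, k + 1}. \<exists>\<beta>\<in>{1 - y, y}.
    (3 * real l + 17) * (1 - x) - \<beta> * (9 * real l + 52) \<notin> \<int>"
proof (rule ccontr)
  assume "\<not> ?thesis"
  then have i: "(3 * real l + 17) * (1 - x) - (1 - y) * (9 * real l + 52) \<in> \<int>"
    "(3 * real l + 17) * (1 - x) - y * (9 * real l + 52) \<in> \<int>" if "l \<in> {k, k + 1}" for l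
    using that by blast+
  have nat: "real n \<in> \<int>" for n by simp
  define s1 where "s1 = (3 * real k + 17) * (1 - x) - (1 - y) * (9 * real k + 52)"
  define s2 where "s2 = (3 * real k + 17) * (1 - x) - y * (9 * real k + 52)"
  define t1 where "t1 = (3 * real k + 20) * (1 - x) - (1 - y) * (9 * real k + 61)"
  define t2 where "t2 = (3 * real k + 20) * (1 - x) - y * (9 * real k + 61)"
  have ints: "s1 \<in> \<int>" "s2 \<in> \<int>" "t1 \<in> \<int>" "t2 \<in> \<int>"
    using i[of k] i[of "k + 1"] by (auto simp: s1_def s2_def t1_def t2_def algebra_simps)
  have x6: "6 * x \<in> \<int>"
  proof -
    have "6 * x = (s1 + s2) - (t1 + t2) - 3"
      by (simp add: s1_def s2_def t1_def t2_def algebra_simps)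
    then show ?thesis using ints by auto
  qed
  have "34 * x \<in> \<int>"
  proof -
    have "34 * x = - (s1 + s2) - of_nat k * (6 * x) - of_nat (3 * k + 18)"
      by (simp add: s1_def s2_def algebra_simps)
    then show ?thesis using ints x6 by auto
  qed
  moreover have "6 * (6 * x) \<in> \<int>" by (rule Ints_mult[OF _ x6]) simp
  \<comment> \<open>The coefficients combine to \<open>36 - 34 = 2\<close>; for \<open>W\<close>
    below, \<open>4 * 52 - 23 * 9 = 1\<close> serves the same purpose.\<close>
  ultimately have "6 * (6 * x) - 34 * x \<in> \<int>" by (intro Ints_diff)
  then have "2 * x \<in> \<int>" by simp
  then obtain u where u: "2 * x = of_int u" by (auto elim: Ints_cases)
  then have "0 < real_of_int u" "real_of_int u < 2" using assms by auto
  then have "u = 1" by linarith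
  then have x: "x = 1 / 2" using u by simp
  define W where "W = 1 - 2 * y"
  have W9: "9 * W \<in> \<int>"
  proof -
    have "9 * W = (t2 - t1) - (s2 - s1)"
      by (simp add: W_def s1_def s2_def t1_def t2_def algebra_simps)
    then show ?thesis using ints by auto
  qed
  have "52 * W \<in> \<int>"
  proof -
    have "52 * W = (s2 - s1) - of_nat k * (9 * W)"
      by (simp add: W_def s1_def s2_def algebra_simps)
    then show ?thesis using ints W9 by auto
  qed
  then have "4 * (52 * W) \<in> \<int>" by (rule Ints_mult[rotated]) simp
  moreover have "23 * (9 * W) \<in> \<int>" by (rule Ints_mult[OF _ W9]) simp
  ultimately have "4 * (52 * W) - 23 * (9 * W) \<in> \<int>" by (intro Ints_diff)
  then have "W \<in> \<int>" by simp
  then obtain v where v: "W = of_int v" by (auto elim: Ints_cases)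
  then have "- 1 < real_of_int v" "real_of_int v < 1" using assms by (auto simp: W_def)
  then have "v = 0" by linarith
  then have y: "y = 1 / 2" using v by (simp add: W_def)
  have "2 * s1 = - 6 * real k - 35"
    unfolding s1_def x y by (simp add: field_simps)
  moreover obtain z where "s1 = of_int z" using ints(1) by (auto elim: Ints_cases)
  ultimately have "real_of_int (2 * z) = real_of_int (- 6 * int k - 35)" by simp
  then have "2 * z = - 6 * int k - 35" unfolding of_int_eq_iff .
  then show False by presburger
qed

theorem corollary6p6:
  fixes P :: "real \<times> real"
  assumes "P \<in> interior ({0..1} \<times> {0..1})"
  shows "\<forall>N::nat. \<exists>s::real. \<exists>q w. tunnels_periodically P s q w \<and> period q w > N"
proof
  fix N :: nat
  obtain x y where P: "P = (x, y)" by (cases P)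
  have "P \<in> {0<..<1} \<times> {0<..<1}" using assms by (simp add: interior_Times)
  then have xy: "0 < x" "x < 1" "0 < y" "y < 1" by (auto simp: P)
  define a where "a = 1 - x"
  have a: "0 < a" "a < 1" using xy by (auto simp: a_def)
  obtain m1 \<delta>1 where 1: "m1 < 4" "0 < \<delta>1"
    "\<And>\<epsilon>. 0 < \<epsilon> \<Longrightarrow> \<epsilon> < \<delta>1 \<Longrightarrow>
       11 * \<epsilon> < a + real m1 - (1 - y) * (3 + \<epsilon>) \<and> a + real m1 - (1 - y) * (3 + \<epsilon>) < 1"
    using start_phase[OF a, of "1 - y"] xy by auto
  obtain m2 \<delta>2 where 2: "m2 < 4" "0 < \<delta>2"
    "\<And>\<epsilon>. 0 < \<epsilon> \<Longrightarrow> \<epsilon> < \<delta>2 \<Longrightarrow>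
       11 * \<epsilon> < a + real m2 - y * (3 + \<epsilon>) \<and> a + real m2 - y * (3 + \<epsilon>) < 1"
    using start_phase[OF a, of y] xy by auto
  define \<delta> where "\<delta> = min \<delta>1 \<delta>2"
  have "0 < \<delta>" using 1(2) 2(2) by (simp add: \<delta>_def)
  \<comment> \<open>Any \<open>l \<ge> k0\<close> makes \<epsilon> smaller than both thresholds,
    whichever sign of the slope is chosen.\<close>
  obtain k0 where k0: "1 / \<delta> < real k0" using reals_Archimedean2 by blast
  obtain l \<beta> where l: "l \<in> {max N k0, max N k0 + 1}" and \<beta>: "\<beta> \<in> {1 - y, y}"
    and corner: "(3 * real l + 17) * (1 - x) - \<beta> * (9 * real l + 52) \<notin> \<int>"
    using avoid_corners[OF xy, of "max N k0"] by blast
  have l: "N \<le> 6 * l" "k0 \<le> l" using l by auto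
  define \<epsilon> where "\<epsilon> = 1 / (3 * real l + 17)"
  define T where "T = 3 + \<epsilon>"
  have \<epsilon>: "0 < \<epsilon>" "(3 * real l + 17) * \<epsilon> = 1" by (simp_all add: \<epsilon>_def)
  have "1 / \<delta> < 3 * real l + 17" using k0 l(2) by linarith
  then have "\<epsilon> < \<delta>" using \<open>0 < \<delta>\<close> by (simp add: \<epsilon>_def field_simps)
  then have \<delta>: "\<epsilon> < \<delta>1" "\<epsilon> < \<delta>2" by (auto simp: \<delta>_def)
  have T: "0 < T" "1 / T \<noteq> 0" using \<epsilon> by (auto simp: T_def)
  have range: "in_range T (a, \<beta> * T, c)" for c
  proof -
    \<comment> \<open>Multiplication by \<open>3 * l + 17\<close> makes \<open>T\<close> the integer
      \<open>9 * l + 52\<close>, so a relation of this form would contradict the choice of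
      \<open>l\<close> and \<beta>.\<close>
    have "a - \<beta> * T \<noteq> of_int u + of_int v * T" for u v
    proof
      assume eq: "a - \<beta> * T = of_int u + of_int v * T"
      have nT: "(3 * real l + 17) * T = 9 * real l + 52"
        using \<epsilon>(2) by (simp add: T_def algebra_simps)
      have "(3 * real l + 17) * (1 - x) - \<beta> * (9 * real l + 52) = (3 * real l + 17) * (a - \<beta> * T)"
        unfolding nT[symmetric] a_def by (simp add: algebra_simps)
      also have "\<dots> = (3 * real l + 17) * of_int u + of_int v * ((3 * real l + 17) * T)"
        unfolding eq by (simp add: algebra_simps)
      also have "\<dots> = of_int ((3 * int l + 17) * u + v * (9 * int l + 52))"
        unfolding nT by simp
      finally show False using corner by (metis Ints_of_int)
    qed
    moreover have "0 < \<beta>" "\<beta> < 1" using \<beta> xy by auto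
    then have "0 < \<beta> * T" "\<beta> * T \<le> T" using T by auto
    ultimately show ?thesis using a by (simp add: in_range_def)
  qed
  show "\<exists>s q w. tunnels_periodically P s q w \<and> period q w > N"
  \<comment> \<open>The distance to the first horizontal line is \<beta>: upwards for
    \<open>1 - y\<close> and slope \<open>1 / T\<close>, downwards for \<open>y\<close> and slope
    \<open>- (1 / T)\<close>, where \<open>flip_y\<close> is applied.\<close>
  proof (cases "\<beta> = 1 - y")
    case True
    have dir: "initial_direction (1 / T) = (1 / sqrt (1 + (1 / T)\<^sup>2)) *\<^sub>R velocity (1 / T) (id entry)"
      by (simp add: initial_direction_def entry_def)
    have "0 < 1 / sqrt (1 + (1 / T)\<^sup>2)" by (simp add: add_pos_nonneg)
    from start_tunnels[OF 1(1) _ _ \<epsilon>_def T_def symmetry_id range this dir l(1)]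
    have "\<exists>q w. tunnels_periodically (position (1 / T) (a, \<beta> * T, id entry, [])) (1 / T) q w \<and>
        period q w > N"
      using 1(3)[OF \<epsilon>(1) \<delta>(1)] by (simp add: True T_def)
    moreover have "position (1 / T) (a, \<beta> * T, id entry, []) = P"
      using T by (simp add: entry_def P a_def True)
    ultimately show ?thesis by auto
  next
    case False
    then have y: "\<beta> = y" using \<beta> by simp
    have dir: "initial_direction (- (1 / T)) =
        (1 / sqrt (1 + (1 / T)\<^sup>2)) *\<^sub>R velocity (1 / T) (flip_y_state entry)"
      by (simp add: initial_direction_def entry_def)
    have "0 < 1 / sqrt (1 + (1 / T)\<^sup>2)" by (simp add: add_pos_nonneg)
    from start_tunnels[OF 2(1) _ _ \<epsilon>_def T_def symmetry_flip_y range this dir l(1)]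
    have "\<exists>q w. tunnels_periodically (position (1 / T) (a, \<beta> * T, flip_y_state entry, []))
        (- (1 / T)) q w \<and> period q w > N"
      using 2(3)[OF \<epsilon>(1) \<delta>(2)] by (simp add: y T_def)
    moreover have "position (1 / T) (a, \<beta> * T, flip_y_state entry, []) = P"
      using T by (simp add: entry_def P a_def y)
    ultimately show ?thesis by auto
  qed
qed

end
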